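(* Consider the linear model $y_k=\mathbf{x}_k^T\boldsymbol\beta+\varepsilon_k$, $k=1,2,\dots$, where $\boldsymbol\beta=(\beta_1,\dots,\beta_p)\in\mathbb{R}^p$ is an unknown parameter, $(\mathbf{x}_k)$ is a sequence of (deterministic) regression vectors in $\mathbb{R}^p$ and $(\varepsilon_k)$ is a strong white noise with variance $\sigma^2$. For $t\ge 0$ let $\widehat{\boldsymbol\beta}_n(t)$ be a minimizer over $\boldsymbol\phi\in\mathbb{R}^p$ of $$\Lambda_n(\boldsymbol\phi,t)=\frac1n\sum_{k=1}^n(y_k-\mathbf{x}_k^T\boldsymbol\phi)^2+t\,\lambda_n\sum_{i=1}^p|\phi_i| .$$ Let $\mathbf{X}_n=[\mathbf{x}_1,\dots,\mathbf{x}_n]^T$ and assume that (i) $C_n=n^{-1}\mathbf{X}_n^T\mathbf{X}_n\to C$ as $n\to\infty$, where $C$ is a positive-definite matrix; (ii) $\max_{1\le k\le n}\|\mathbf{x}_k\|^2=o(n)$; (iii) $\lambda_n=n^{-1/2}$. Let $U\sim\mathcal{N}(0,\sigma^2C)$ and, for any $t\ge0$, let $\widehat{\mathbf u}(t)$ be the (unique) point $\boldsymbol\phi\in\mathbb{R}^p$ which minimizes $$\mathbb{L}(\boldsymbol\phi,t)=-2U^T\boldsymbol\phi+\boldsymbol\phi^TC\boldsymbol\phi+t\sum_{j=1}^p\Big[\phi_j\,\mathrm{sgn}(\beta_j)\mathbf{1}_{\{\beta_j\ne0\}}+|\phi_j|\mathbf{1}_{\{\beta_j=0\}}\Big].$$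 Then $$\sqrt n\,(\widehat{\boldsymbol\beta}_n-\boldsymbol\beta)\rightsquigarrow\widehat{\mathbf u}\quad\text{in }\ell^\infty_o(\mathbb{R}_+,\mathbb{R}^p).$$
   Context: A strong white noise with variance $\sigma^2$ is a sequence of i.i.d. centered real random variables with variance $\sigma^2<\infty$. The dimension $p$ is fixed. $\mathbb{R}_+=[0,\infty)$, and $\ell^\infty_o(\mathbb{R}_+,\mathbb{R}^p)$ denotes the space of locally bounded functions $\mathbb{R}_+\to\mathbb{R}^p$, endowed with the (metrizable) topology of uniform convergence on every compact subset of $\mathbb{R}_+$. Weak convergence $\rightsquigarrow$ is in the sense of Hoffmann-Jørgensen (van der Vaart and Wellner): for a metric space $\mathcal D$, a sequence of $\mathcal D$-valued maps $X_n$ (not necessarily measurable) defined on the underlying probability space converges weakly to $X$, denoted $X_n\rightsquigarrow X$, if $X$ is a Borel map and $E^*[f(X_n)]\to E[f(X)]$ for every bounded continuous $f:\mathcal D\to\mathbb{R}$, where $E^*[Z]=\inf\{E[V]: V\ge Z,\ V\text{ measurable}\}$ is the outer expectation. In $\sqrt n(\widehat{\boldsymbol\beta}_n-\boldsymbol\beta)$, $\boldsymbol\beta$ is viewed as the constant function $t\mapsto\boldsymbol\beta$. *)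

theory Defs
  imports "HOL-Probability.Probability" "HOL-Library.Landau_Symbols"
begin

section \<open>Locally bounded functions on the half-line\<close>

(* Functions on [0,\<infinity>) are represented by extensional functions on the reals, so that two elements
   of the space are equal iff they agree on [0,\<infinity>). *)
definition loc_bounded_funs :: "(real \<Rightarrow> 'v::real_normed_vector) set" where
  "loc_bounded_funs =
     {f \<in> extensional {0..}. \<forall>t\<ge>0. \<exists>e>0. bounded (f ` ({0..} \<inter> ball t e))}"

(* The topology of uniform convergence on compact sets: U is open iff around each f in U it contains
   all g of the space that are uniformly e-close to f on some compact set K. *)
definition loc_unif_topology :: "(real \<Rightarrow> 'v::real_normed_vector) topology" where
  "loc_unif_topology = topology (\<lambda>U. U \<subseteq> loc_bounded_funs \<and>
     (\<forall>f\<in>U. \<exists>K e. compact K \<and> K \<subseteq> {0..} \<and> e > 0 \<and>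
        (\<forall>g\<in>loc_bounded_funs. (\<forall>t\<in>K. dist (g t) (f t) < e) \<longrightarrow> g \<in> U)))"

lemma openin_loc_unif_topology:
  "openin loc_unif_topology U \<longleftrightarrow> U \<subseteq> loc_bounded_funs \<and>
     (\<forall>f\<in>U. \<exists>K e. compact K \<and> K \<subseteq> {0..} \<and> e > 0 \<and>
        (\<forall>g\<in>loc_bounded_funs. (\<forall>t\<in>K. dist (g t) (f t) < e) \<longrightarrow> g \<in> U))"
    (is "_ \<longleftrightarrow> ?P U")
proof -
  have "istopology ?P"
    unfolding istopology_def
  proof (intro conjI allI impI)
    fix S T assume S: "?P S" and T: "?P T"
    show "S \<inter> T \<subseteq> loc_bounded_funs" using S by blast
    show "\<forall>f\<in>S \<inter> T. \<exists>K e. compact K \<and> K \<subseteq> {0..} \<and> e > 0 \<and>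
        (\<forall>g\<in>loc_bounded_funs. (\<forall>t\<in>K. dist (g t) (f t) < e) \<longrightarrow> g \<in> S \<inter> T)"
    proof
      fix f assume f: "f \<in> S \<inter> T"
      obtain K d where K: "compact K" "K \<subseteq> {0..}" "d > 0"
        "\<And>g. g \<in> loc_bounded_funs \<Longrightarrow> (\<forall>t\<in>K. dist (g t) (f t) < d) \<Longrightarrow> g \<in> S"
        using S f by (meson IntD1)
      obtain L e where L: "compact L" "L \<subseteq> {0..}" "e > 0"
        "\<And>g. g \<in> loc_bounded_funs \<Longrightarrow> (\<forall>t\<in>L. dist (g t) (f t) < e) \<Longrightarrow> g \<in> T"
        using T f by (meson IntD2)
      show "\<exists>K e. compact K \<and> K \<subseteq> {0..} \<and> e > 0 \<and>
        (\<forall>g\<in>loc_bounded_funs. (\<forall>t\<in>K. dist (g t) (f t) < e) \<longrightarrow> g \<in> S \<inter> T)"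
        using K L by (intro exI[of _ "K \<union> L"] exI[of _ "min d e"]) auto
    qed
  next
    fix \<K> assume H: "\<forall>S\<in>\<K>. ?P S"
    show "\<Union>\<K> \<subseteq> loc_bounded_funs" using H by blast
    show "\<forall>f\<in>\<Union>\<K>. \<exists>K e. compact K \<and> K \<subseteq> {0..} \<and> e > 0 \<and>
        (\<forall>g\<in>loc_bounded_funs. (\<forall>t\<in>K. dist (g t) (f t) < e) \<longrightarrow> g \<in> \<Union>\<K>)"
      using H by (meson Union_iff)
  qed
  then show ?thesis
    unfolding loc_unif_topology_def by (simp add: topology_inverse')
qed

lemma topspace_loc_unif_topology [simp]: "topspace loc_unif_topology = loc_bounded_funs"
proof
  show "topspace loc_unif_topology \<subseteq> (loc_bounded_funs :: (real \<Rightarrow> 'a) set)"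
    using openin_loc_unif_topology openin_topspace by blast
  have "openin loc_unif_topology (loc_bounded_funs :: (real \<Rightarrow> 'a) set)"
    unfolding openin_loc_unif_topology
    by (auto intro!: exI[of _ "{}"] exI[of _ "1::real"])
  then show "loc_bounded_funs \<subseteq> topspace (loc_unif_topology :: (real \<Rightarrow> 'a) topology)"
    by (rule openin_subset)
qed


section \<open>Weak convergence in the sense of Hoffmann-J{\o}rgensen\<close>

definition borel_of_topology :: "'d topology \<Rightarrow> 'd measure" where
  "borel_of_topology T = sigma (topspace T) {U. openin T U}"

(* The real-valued form of the outer expectation, for bounded Z; there, majorants with infinite
   expectation do not affect the infimum, and the integral of a non-integrable function is 0 by
   convention, hence the integrability requirement. *)
definition outer_expectation :: "'a measure \<Rightarrow> ('a \<Rightarrow> real) \<Rightarrow> real" where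
  "outer_expectation M Z =
     Inf {integral\<^sup>L M V | V. integrable M V \<and> (\<forall>\<omega>\<in>space M. Z \<omega> \<le> V \<omega>)}"

(* The maps X n on M need not be measurable; the limit Y may live on another probability space N. *)
definition weakly_converges ::
    "'d topology \<Rightarrow> 'a measure \<Rightarrow> (nat \<Rightarrow> 'a \<Rightarrow> 'd) \<Rightarrow> 'b measure \<Rightarrow> ('b \<Rightarrow> 'd) \<Rightarrow> bool" where
  "weakly_converges T M X N Y \<longleftrightarrow>
     (\<forall>n. X n \<in> space M \<rightarrow> topspace T) \<and>
     Y \<in> measurable N (borel_of_topology T) \<and>
     (\<forall>f. continuous_map T euclideanreal f \<and> bounded (f ` topspace T) \<longrightarrow>
        (\<lambda>n. outer_expectation M (\<lambda>\<omega>. f (X n \<omega>))) \<longlonglongrightarrow> (\<integral>\<omega>. f (Y \<omega>) \<partial>N))"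


section \<open>White noise and Gaussian vectors\<close>

definition strong_white_noise :: "'a measure \<Rightarrow> (nat \<Rightarrow> 'a \<Rightarrow> real) \<Rightarrow> real \<Rightarrow> bool" where
  "strong_white_noise M \<epsilon> v \<longleftrightarrow>
     prob_space M \<and>
     prob_space.indep_vars M (\<lambda>_. borel) \<epsilon> {1..} \<and>
     (\<forall>k\<ge>1. distr M borel (\<epsilon> k) = distr M borel (\<epsilon> 1)) \<and>
     (\<forall>k\<ge>1. integrable M (\<lambda>\<omega>. (\<epsilon> k \<omega>)\<^sup>2) \<and>
        prob_space.expectation M (\<epsilon> k) = 0 \<and> prob_space.variance M (\<epsilon> k) = v)"

(* The law N(m, v) on the line, as the law of m + sqrt v * Z with Z standard normal; this includes
   the degenerate case v = 0. *)
definition normal_law :: "real \<Rightarrow> real \<Rightarrow> real measure" where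
  "normal_law m v = distr std_normal_distribution borel (\<lambda>z. m + sqrt v * z)"

(* U ~ N(\<mu>, \<Sigma>): every linear functional of U is univariate normal with the matching mean and
   variance. *)
definition gaussian_vector ::
    "'b measure \<Rightarrow> real ^ 'p::finite \<Rightarrow> real ^ 'p ^ 'p \<Rightarrow> ('b \<Rightarrow> real ^ 'p) \<Rightarrow> bool" where
  "gaussian_vector N \<mu> \<Sigma> U \<longleftrightarrow>
     prob_space N \<and> U \<in> borel_measurable N \<and>
     (\<forall>a. distr N borel (\<lambda>\<omega>. a \<bullet> U \<omega>) = normal_law (a \<bullet> \<mu>) (a \<bullet> (\<Sigma> *v a)))"


section \<open>The Lasso criterion and its limit\<close>

(* The matrix (1/n) X^T X, where X is the n-by-p matrix with rows x 1, ..., x n. *)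
definition gram_matrix :: "(nat \<Rightarrow> real ^ 'p::finite) \<Rightarrow> nat \<Rightarrow> real ^ 'p ^ 'p" where
  "gram_matrix x n = (\<chi> i j. (\<Sum>k=1..n. x k $ i * x k $ j) / real n)"

definition pos_def_matrix :: "real ^ 'p::finite ^ 'p \<Rightarrow> bool" where
  "pos_def_matrix A \<longleftrightarrow> transpose A = A \<and> (\<forall>v. v \<noteq> 0 \<longrightarrow> v \<bullet> (A *v v) > 0)"

definition lasso_objective ::
    "(nat \<Rightarrow> real ^ 'p::finite) \<Rightarrow> (nat \<Rightarrow> real) \<Rightarrow> (nat \<Rightarrow> real) \<Rightarrow> nat \<Rightarrow> real ^ 'p \<Rightarrow> real \<Rightarrow> real" where
  "lasso_objective x y lam n \<phi> t =
     (1 / real n) * (\<Sum>k=1..n. (y k - x k \<bullet> \<phi>)\<^sup>2) + t * lam n * (\<Sum>i\<in>UNIV. \<bar>\<phi> $ i\<bar>)"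

definition limit_objective ::
    "real ^ 'p::finite ^ 'p \<Rightarrow> real ^ 'p \<Rightarrow> real ^ 'p \<Rightarrow> real ^ 'p \<Rightarrow> real \<Rightarrow> real" where
  "limit_objective C \<beta> u \<phi> t =
     - 2 * (u \<bullet> \<phi>) + \<phi> \<bullet> (C *v \<phi>)
     + t * (\<Sum>j\<in>UNIV. \<phi> $ j * sgn (\<beta> $ j) * of_bool (\<beta> $ j \<noteq> 0) + \<bar>\<phi> $ j\<bar> * of_bool (\<beta> $ j = 0))"

definition is_minimizer :: "('v \<Rightarrow> real) \<Rightarrow> 'v \<Rightarrow> bool" where
  "is_minimizer F \<phi> \<longleftrightarrow> is_arg_min F (\<lambda>_. True) \<phi>"

definition limit_minimizer :: "real ^ 'p::finite ^ 'p \<Rightarrow> real ^ 'p \<Rightarrow> real ^ 'p \<Rightarrow> real \<Rightarrow> real ^ 'p" where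
  "limit_minimizer C \<beta> u t = (THE \<phi>. is_minimizer (\<lambda>\<phi>. limit_objective C \<beta> u \<phi> t) \<phi>)"

end

theory Submission
  imports Defs
begin

text \<open>
  In the local parameter \<open>v = sqrt n *\<^sub>R (\<phi> - \<beta>)\<close> the Lasso criterion is, up to an additive
  constant and the factor \<open>1 / n\<close>,
  \<open>- 2 * (W \<bullet> v) + v \<bullet> (C\<^sub>n *v v) + t * Q\<^sub>n v\<close>, where \<open>W = n\<^sup>-\<^sup>1\<^sup>/\<^sup>2 X\<^sub>n\<^sup>T \<epsilon>\<close> is the score,
  \<open>C\<^sub>n\<close> the Gram matrix and \<open>Q\<^sub>n\<close> a difference quotient of the \<open>\<ell>\<^sup>1\<close> norm at \<open>\<beta>\<close>
  (\<open>lasso_objective_expansion\<close>). The limiting criterion has the same form, with \<open>U\<close>, \<open>C\<close> and the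
  directional derivative of the \<open>\<ell>\<^sup>1\<close> norm. All randomness enters through one finite-dimensional
  vector, and the theorem splits into a deterministic and a probabilistic part.

  Deterministically, the quadratic term makes the criteria strongly convex
  (\<open>quadratic_growth_at_minimizer\<close>). Hence the limiting minimizer exists, is unique, and is a
  Lipschitz function of \<open>u\<close> with a constant that does not depend on \<open>t\<close>; so \<open>u\<close> is mapped
  continuously to the whole path \<open>t \<mapsto> limit_minimizer C \<beta> u t\<close>. Moreover, while the score stays in a
  ball and \<open>t\<close> in a compact interval, the rescaled Lasso minimizer is uniformly close to the
  limiting minimizer \<^emph>\<open>for the same score\<close> (\<open>minimizers_converge_uniformly\<close>): the minimizers stay
  in a fixed ball, where the penalties agree exactly because the \<open>\<ell>\<^sup>1\<close> norm is piecewise linear.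

  Probabilistically, the score converges in law to \<open>U\<close>. The characteristic functions converge by a
  central limit theorem for weighted i.i.d. sums (\<open>score_cis_expectation_tendsto\<close>), and this
  implies weak convergence of the random vectors by a multivariate version of Levy's continuity
  theorem (\<open>Levy_continuity_multivariate\<close>), which follows from the one-dimensional theorem
  for tightness and the Stone--Weierstrass theorem for the identification of the limit.

  A continuous mapping theorem that tolerates nonmeasurable paths near a continuous image of the
  score (\<open>weakly_convergesI_continuous_image\<close>) joins the two parts.
\<close>

section \<open>Trigonometric polynomials\<close>

text \<open>Linearity reduces the convergence of expectations of trigonometric polynomials to that of
  characteristic functions. Closure under products, which the approximation theorem needs,
  comes from \<open>cis s * cis t = cis (s + t)\<close>.\<close>

inductive trig_poly :: "('v::real_inner \<Rightarrow> complex) \<Rightarrow> bool" where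
  monomial: "trig_poly (\<lambda>x. c * cis (a \<bullet> x))"
| add: "trig_poly f \<Longrightarrow> trig_poly g \<Longrightarrow> trig_poly (\<lambda>x. f x + g x)"

lemma trig_poly_const: "trig_poly (\<lambda>x. c)"
  using trig_poly.monomial[of c 0] by simp

lemma trig_poly_mult:
  assumes "trig_poly f" "trig_poly g"
  shows "trig_poly (\<lambda>x. f x * g x)"
  using assms(1)
proof induction
  case (monomial c a)
  show ?case
    using assms(2)
  proof induction
    case (monomial d b)
    have "(\<lambda>x. c * cis (a \<bullet> x) * (d * cis (b \<bullet> x))) = (\<lambda>x. (c * d) * cis ((a + b) \<bullet> x))"
      by (simp add: inner_add_left cis_mult[symmetric] fun_eq_iff)
    then show ?case
      using trig_poly.monomial[of "c * d" "a + b"] by simp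
  next
    case (add f g)
    then show ?case
      by (simp add: distrib_left trig_poly.add)
  qed
next
  case (add f g)
  then show ?case
    by (simp add: distrib_right trig_poly.add)
qed

lemma trig_poly_sum:
  "finite A \<Longrightarrow> (\<And>i. i \<in> A \<Longrightarrow> trig_poly (f i)) \<Longrightarrow> trig_poly (\<lambda>x. \<Sum>i\<in>A. f i x)"
  by (induction rule: finite_induct) (auto simp: trig_poly_const trig_poly.add)

lemma trig_poly_sin:
  "trig_poly (\<lambda>x. complex_of_real (sin (a \<bullet> x)))"
proof -
  have eq: "(\<lambda>x. complex_of_real (sin (a \<bullet> x)))
      = (\<lambda>x. (- \<i> / 2) * cis (a \<bullet> x) + (\<i> / 2) * cis ((- a) \<bullet> x))"
    by (auto simp: fun_eq_iff complex_eq_iff)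
  show ?thesis
    unfolding eq by (intro trig_poly.intros)
qed

lemma trig_poly_of_polynomial_of_sines:
  fixes P :: "real ^ 'p::finite \<Rightarrow> real"
  assumes "real_polynomial_function P"
  shows "trig_poly (\<lambda>x. complex_of_real (P (\<chi> j. sin (s * x $ j))))"
  using assms
proof induction
  case (linear P)
  interpret P: bounded_linear P by fact
  have P_eq: "P z = (\<Sum>j\<in>UNIV. z $ j * P (axis j 1))" for z
  proof -
    have "P z = P (\<Sum>j\<in>UNIV. z $ j *\<^sub>R axis j 1)"
      using basis_expansion[of z] by (simp add: scalar_mult_eq_scaleR)
    then show ?thesis
      by (simp add: P.sum P.scale)
  qed
  have "trig_poly (\<lambda>x. complex_of_real (sin (s * x $ j) * P (axis j 1)))" for j
    using trig_poly_mult[OF trig_poly_sin[of "axis j s"] trig_poly_const]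
    by (simp add: inner_axis')
  then show ?case
    by (subst P_eq) (simp add: trig_poly_sum del: of_real_mult)
next
  case (const c)
  show ?case by (rule trig_poly_const)
next
  case (add f g)
  then show ?case by (simp add: trig_poly.add)
next
  case (mult f g)
  then show ?case by (simp add: trig_poly_mult)
qed

text \<open>A trigonometric polynomial cannot in general approximate \<open>h\<close> uniformly on the whole space, but it
  can do so on a ball while keeping the bound of \<open>h\<close> everywhere. The map \<open>x \<mapsto> sin (s * x)\<close>, applied to every
  coordinate, sends the whole space into a cube and, for small \<open>s\<close>, is inverted on the ball by the
  arcsine. So \<open>h\<close> is carried over to the cube by the arcsine, approximated there by an ordinary
  polynomial, and pulled back by the sine: on the ball this returns an approximation of \<open>h\<close>, and
  elsewhere the values still approximate values of \<open>h\<close>, though at other points.\<close>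

lemma trig_poly_approximation:
  fixes h :: "real ^ 'p::finite \<Rightarrow> real"
  assumes cont: "continuous_on UNIV h" and bound: "\<And>x. \<bar>h x\<bar> \<le> B" and e: "0 < e"
  obtains g where "trig_poly (\<lambda>x. complex_of_real (g x))"
    "\<And>x. norm x \<le> r \<Longrightarrow> \<bar>g x - h x\<bar> \<le> e" "\<And>x. \<bar>g x\<bar> \<le> B + e"
proof -
  \<comment> \<open>This scale puts the ball of radius \<open>r\<close> where the sine is injective: \<open>s * \<bar>r\<bar> \<le> 1 \<le> pi / 2\<close>.\<close>
  define s where "s = 1 / (\<bar>r\<bar> + 1)"
  have s: "s > 0" by (simp add: s_def)
  let ?S = "cbox (\<chi> j. - 1) (\<chi> j. 1) :: (real ^ 'p) set"
  define f where "f z = h (\<chi> j. arcsin (z $ j) / s)" for z :: "real ^ 'p"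
  have "continuous_on ?S f"
    unfolding f_def
    by (rule continuous_on_compose2[OF cont])
      (use s in \<open>auto simp: mem_box_cart intro!: continuous_intros\<close>)
  then obtain P where P: "real_polynomial_function P" "\<And>z. z \<in> ?S \<Longrightarrow> \<bar>f z - P z\<bar> < e"
    using Stone_Weierstrass_real_polynomial_function[OF compact_cbox _ e] by metis
  let ?q = "\<lambda>x::real ^ 'p. (\<chi> j. sin (s * x $ j)) :: real ^ 'p"
  have q: "?q x \<in> ?S" for x
    by (simp add: mem_box_cart)
  show thesis
  proof
    show "trig_poly (\<lambda>x. complex_of_real (P (?q x)))"
      by (rule trig_poly_of_polynomial_of_sines[OF P(1)])
    show "\<bar>P (?q x)\<bar> \<le> B + e" for x
      using P(2)[OF q[of x]] bound[of "(\<chi> j. arcsin (?q x $ j) / s)"] by (simp add: f_def)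
    show "\<bar>P (?q x) - h x\<bar> \<le> e" if "norm x \<le> r" for x
    proof -
      have "arcsin (sin (s * x $ j)) = s * x $ j" for j
      proof -
        have "\<bar>s * x $ j\<bar> \<le> s * \<bar>r\<bar>"
          using component_le_norm_cart[of x j] that s by (simp add: abs_mult)
        also have "\<dots> \<le> 1"
          by (simp add: s_def)
        also have "1 \<le> pi / 2"
          using pi_gt3 by simp
        finally show ?thesis
          by (intro arcsin_sin) auto
      qed
      then have "f (?q x) = h x"
        using s by (simp add: f_def)
      then show ?thesis
        using P(2)[OF q[of x]] by simp
    qed
  qed
qed

section \<open>The multivariate Levy continuity theorem\<close>

lemma integrable_cis_inner:
  assumes "prob_space M" and [measurable]: "X \<in> borel_measurable M"
  shows "integrable M (\<lambda>\<omega>. cis (a \<bullet> (X \<omega> :: 'v::euclidean_space)))"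
proof -
  interpret prob_space M by fact
  have "(\<lambda>\<omega>. cis (a \<bullet> X \<omega>)) \<in> borel_measurable M"
    unfolding cis_conv_exp by measurable
  then show ?thesis
    by (intro integrable_const_bound[where B=1]) auto
qed

lemma trig_poly_expectation_tendsto:
  fixes V :: "nat \<Rightarrow> 'a \<Rightarrow> 'v::euclidean_space" and U :: "'b \<Rightarrow> 'v"
  assumes "prob_space M" "prob_space N"
    and meas: "\<And>n. V n \<in> borel_measurable M" "U \<in> borel_measurable N"
    and char: "\<And>a. (\<lambda>n. \<integral>\<omega>. cis (a \<bullet> V n \<omega>) \<partial>M) \<longlonglongrightarrow> (\<integral>\<omega>. cis (a \<bullet> U \<omega>) \<partial>N)"
    and g: "trig_poly g"
  shows "(\<lambda>n. \<integral>\<omega>. g (V n \<omega>) \<partial>M) \<longlonglongrightarrow> (\<integral>\<omega>. g (U \<omega>) \<partial>N)"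
proof -
  note int = integrable_cis_inner[OF assms(1) meas(1)] integrable_cis_inner[OF assms(2) meas(2)]
  have "(\<forall>n. integrable M (\<lambda>\<omega>. g (V n \<omega>))) \<and> integrable N (\<lambda>\<omega>. g (U \<omega>)) \<and>
    (\<lambda>n. \<integral>\<omega>. g (V n \<omega>) \<partial>M) \<longlonglongrightarrow> (\<integral>\<omega>. g (U \<omega>) \<partial>N)"
    using g
  proof induction
    case (monomial c a)
    then show ?case
      using int char by (auto intro!: tendsto_intros)
  next
    case (add f g)
    then show ?case
      by (auto intro!: tendsto_intros)
  qed
  then show ?thesis by simp
qed

text \<open>A continuous stand-in for the indicator of the complement of a ball, so that weak convergence
  can be applied to tail probabilities.\<close>

definition tail_cutoff :: "real \<Rightarrow> 'v::real_normed_vector \<Rightarrow> real" where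
  "tail_cutoff r x = min 1 (max 0 (norm x - r))"

lemma tail_cutoff_simps:
  "0 \<le> tail_cutoff r x" "tail_cutoff r x \<le> 1"
  "norm x \<le> r \<Longrightarrow> tail_cutoff r x = 0" "r + 1 \<le> norm x \<Longrightarrow> tail_cutoff r x = 1"
  by (auto simp: tail_cutoff_def)

lemma continuous_on_tail_cutoff: "continuous_on S (tail_cutoff r)"
  unfolding tail_cutoff_def[abs_def] by (intro continuous_intros)

lemma tail_cutoff_expectation_small:
  fixes U :: "'b \<Rightarrow> 'v::{real_normed_vector, second_countable_topology}"
  assumes "prob_space N" and U [measurable]: "U \<in> borel_measurable N" and e: "0 < e"
  obtains r where "(\<integral>\<omega>. tail_cutoff r (U \<omega>) \<partial>N) < e"
proof -
  interpret N: prob_space N by fact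
  have [measurable]: "(tail_cutoff r :: 'v \<Rightarrow> real) \<in> borel_measurable borel" for r
    by (intro borel_measurable_continuous_onI continuous_on_tail_cutoff)
  have "(\<lambda>n. \<integral>\<omega>. tail_cutoff (real n) (U \<omega>) \<partial>N) \<longlonglongrightarrow> (\<integral>\<omega>. 0 \<partial>N)"
  proof (rule integral_dominated_convergence[where w = "\<lambda>_. 1"])
    show "AE \<omega> in N. (\<lambda>n. tail_cutoff (real n) (U \<omega>)) \<longlonglongrightarrow> 0"
    proof (rule AE_I2)
      fix \<omega>
      obtain m :: nat where "norm (U \<omega>) \<le> m"
        using real_arch_simple by blast
      then have "\<forall>\<^sub>F n in sequentially. tail_cutoff (real n) (U \<omega>) = 0"
        by (intro eventually_sequentiallyI[of m]) (simp add: tail_cutoff_simps)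
      then show "(\<lambda>n. tail_cutoff (real n) (U \<omega>)) \<longlonglongrightarrow> 0"
        by (rule tendsto_eventually)
    qed
  qed (auto simp: tail_cutoff_simps)
  then have "\<forall>\<^sub>F n in sequentially. (\<integral>\<omega>. tail_cutoff (real n) (U \<omega>) \<partial>N) < e"
    using e by (intro order_tendstoD) auto
  then obtain n :: nat where "(\<integral>\<omega>. tail_cutoff (real n) (U \<omega>) \<partial>N) < e"
    using eventually_happens' sequentially_bot by blast
  then show thesis
    by (rule that)
qed

text \<open>The characteristic function of \<open>b \<bullet> V\<close> at \<open>t\<close> is that of the vector at \<open>t *\<^sub>R b\<close>, so the
  one-dimensional continuity theorem applies to every linear functional.\<close>

lemma marginal_expectation_tendsto:
  fixes V :: "nat \<Rightarrow> 'a \<Rightarrow> 'v::euclidean_space" and U :: "'b \<Rightarrow> 'v" and f :: "real \<Rightarrow> real"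
  assumes "prob_space M" "prob_space N"
    and meas [measurable]: "\<And>n. V n \<in> borel_measurable M" "U \<in> borel_measurable N"
    and char: "\<And>a. (\<lambda>n. \<integral>\<omega>. cis (a \<bullet> V n \<omega>) \<partial>M) \<longlonglongrightarrow> (\<integral>\<omega>. cis (a \<bullet> U \<omega>) \<partial>N)"
    and f: "continuous_on UNIV f" "\<And>x. \<bar>f x\<bar> \<le> B"
  shows "(\<lambda>n. \<integral>\<omega>. f (b \<bullet> V n \<omega>) \<partial>M) \<longlonglongrightarrow> (\<integral>\<omega>. f (b \<bullet> U \<omega>) \<partial>N)"
proof -
  interpret M: prob_space M by fact
  interpret N: prob_space N by fact
  have real_distr: "real_distribution (distr M borel (\<lambda>\<omega>. b \<bullet> V n \<omega>))"
    "real_distribution (distr N borel (\<lambda>\<omega>. b \<bullet> U \<omega>))" for n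
    by (auto intro!: M.real_distribution_distr N.real_distribution_distr)
  have "char (distr M borel (\<lambda>\<omega>. b \<bullet> V n \<omega>)) t = (\<integral>\<omega>. cis ((t *\<^sub>R b) \<bullet> V n \<omega>) \<partial>M)"
    "char (distr N borel (\<lambda>\<omega>. b \<bullet> U \<omega>)) t = (\<integral>\<omega>. cis ((t *\<^sub>R b) \<bullet> U \<omega>) \<partial>N)" for n t
    by (simp_all add: char_def integral_distr cis_conv_exp)
  then have "weak_conv_m (\<lambda>n. distr M borel (\<lambda>\<omega>. b \<bullet> V n \<omega>)) (distr N borel (\<lambda>\<omega>. b \<bullet> U \<omega>))"
    by (intro levy_continuity real_distr) (simp only: char)
  then have "(\<lambda>n. integral\<^sup>L (distr M borel (\<lambda>\<omega>. b \<bullet> V n \<omega>)) f)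
      \<longlonglongrightarrow> integral\<^sup>L (distr N borel (\<lambda>\<omega>. b \<bullet> U \<omega>)) f"
    using f by (intro weak_conv_imp_integral_bdd_continuous_conv[where B = B] real_distr)
      (auto simp: continuous_on_eq_continuous_at)
  moreover have [measurable]: "f \<in> borel_measurable borel"
    using f(1) by (rule borel_measurable_continuous_onI)
  ultimately show ?thesis
    by (simp add: integral_distr)
qed

text \<open>Tightness is inherited from the coordinates: a vector with a large norm has a large coordinate,
  and each coordinate converges weakly by the one-dimensional theorem.\<close>

lemma tight_of_char_tendsto:
  fixes V :: "nat \<Rightarrow> 'a \<Rightarrow> 'v::euclidean_space" and U :: "'b \<Rightarrow> 'v"
  assumes prob: "prob_space M" "prob_space N"
    and meas [measurable]: "\<And>n. V n \<in> borel_measurable M" "U \<in> borel_measurable N"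
    and char: "\<And>a. (\<lambda>n. \<integral>\<omega>. cis (a \<bullet> V n \<omega>) \<partial>M) \<longlonglongrightarrow> (\<integral>\<omega>. cis (a \<bullet> U \<omega>) \<partial>N)"
    and e: "0 < e"
  obtains r where "\<forall>\<^sub>F n in sequentially. (\<integral>\<omega>. tail_cutoff r (V n \<omega>) \<partial>M) < e"
proof -
  interpret M: prob_space M by fact
  interpret N: prob_space N by fact
  have [measurable]: "(tail_cutoff r :: 'v \<Rightarrow> real) \<in> borel_measurable borel"
    "(tail_cutoff r :: real \<Rightarrow> real) \<in> borel_measurable borel" for r
    by (intro borel_measurable_continuous_onI continuous_on_tail_cutoff)+
  let ?d = "real (DIM('v))"
  have "\<exists>r. (\<integral>\<omega>. tail_cutoff r (b \<bullet> U \<omega>) \<partial>N) < e / ?d" for b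
    using tail_cutoff_expectation_small[OF prob(2), of "\<lambda>\<omega>. b \<bullet> U \<omega>" "e / ?d"] e by auto
  then obtain R where R: "\<And>b. (\<integral>\<omega>. tail_cutoff (R b) (b \<bullet> U \<omega>) \<partial>N) < e / ?d"
    by metis
  have "\<forall>\<^sub>F n in sequentially. (\<integral>\<omega>. tail_cutoff (R b) (b \<bullet> V n \<omega>) \<partial>M) < e / ?d" for b
    by (rule order_tendstoD(2)[OF marginal_expectation_tendsto[OF prob meas char, where B = 1] R])
      (auto simp: tail_cutoff_simps continuous_on_tail_cutoff)
  then have ev: "\<forall>\<^sub>F n in sequentially.
      \<forall>b\<in>Basis. (\<integral>\<omega>. tail_cutoff (R b) (b \<bullet> V n \<omega>) \<partial>M) < e / ?d"
    by (intro eventually_ball_finite) auto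
  define r where "r = (\<Sum>b\<in>Basis. R b + 1)"
  have r: "tail_cutoff r v \<le> (\<Sum>b\<in>Basis. tail_cutoff (R b) (b \<bullet> v))" for v :: 'v
  proof (cases "norm v \<le> r")
    case True
    then show ?thesis
      by (simp add: tail_cutoff_simps sum_nonneg)
  next
    case False
    have "\<exists>b\<in>Basis. R b + 1 \<le> \<bar>b \<bullet> v\<bar>"
    proof (rule ccontr)
      assume "\<not> ?thesis"
      then have "(\<Sum>b\<in>Basis. \<bar>v \<bullet> b\<bar>) \<le> r"
        unfolding r_def by (intro sum_mono) (auto simp: inner_commute not_le less_imp_le)
      with False norm_le_l1[of v] show False by simp
    qed
    then obtain b where b: "b \<in> Basis" "R b + 1 \<le> \<bar>b \<bullet> v\<bar>" by blast
    have "tail_cutoff r v \<le> tail_cutoff (R b) (b \<bullet> v)"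
      using b(2) by (simp add: tail_cutoff_simps)
    also have "\<dots> \<le> (\<Sum>b\<in>Basis. tail_cutoff (R b) (b \<bullet> v))"
      by (rule member_le_sum) (use b in \<open>auto simp: tail_cutoff_simps\<close>)
    finally show ?thesis .
  qed
  have int: "integrable M (\<lambda>\<omega>. tail_cutoff q (V n \<omega>))"
    "integrable M (\<lambda>\<omega>. tail_cutoff q (b \<bullet> V n \<omega>))" for q n b
    by (auto intro!: M.integrable_const_bound[where B = 1] simp: tail_cutoff_simps)
  show thesis
  proof
    show "\<forall>\<^sub>F n in sequentially. (\<integral>\<omega>. tail_cutoff r (V n \<omega>) \<partial>M) < e"
      using ev
    proof eventually_elim
      case (elim n)
      have "(\<integral>\<omega>. tail_cutoff r (V n \<omega>) \<partial>M)
          \<le> (\<integral>\<omega>. (\<Sum>b\<in>Basis. tail_cutoff (R b) (b \<bullet> V n \<omega>)) \<partial>M)"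
        by (intro integral_mono int Bochner_Integration.integrable_sum r)
      also have "\<dots> = (\<Sum>b\<in>Basis. \<integral>\<omega>. tail_cutoff (R b) (b \<bullet> V n \<omega>) \<partial>M)"
        by (intro Bochner_Integration.integral_sum int)
      also have "\<dots> < (\<Sum>b\<in>(Basis::'v set). e / ?d)"
        using elim by (intro sum_strict_mono) auto
      finally show ?case by simp
    qed
  qed
qed

text \<open>For functions that are close on a ball and bounded off it, the expectations differ only by the
  closeness and a multiple of the tail mass.\<close>

lemma expectation_diff_le_tail:
  fixes g h :: "'v::{real_normed_vector, second_countable_topology} \<Rightarrow> real"
  assumes "prob_space P" and [measurable]: "X \<in> borel_measurable P"
    and [measurable]: "g \<in> borel_measurable borel" "h \<in> borel_measurable borel"
    and bounds: "\<And>x. \<bar>g x\<bar> \<le> A" "\<And>x. \<bar>h x\<bar> \<le> B"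
    and close: "\<And>x. \<bar>g x - h x\<bar> \<le> e + K * tail_cutoff q x"
  shows "\<bar>(\<integral>\<omega>. g (X \<omega>) \<partial>P) - (\<integral>\<omega>. h (X \<omega>) \<partial>P)\<bar> \<le> e + K * (\<integral>\<omega>. tail_cutoff q (X \<omega>) \<partial>P)"
proof -
  interpret P: prob_space P by fact
  have [measurable]: "(tail_cutoff q :: 'v \<Rightarrow> real) \<in> borel_measurable borel"
    by (intro borel_measurable_continuous_onI continuous_on_tail_cutoff)
  have int: "integrable P (\<lambda>\<omega>. g (X \<omega>))" "integrable P (\<lambda>\<omega>. h (X \<omega>))"
    by (rule P.integrable_const_bound[where B = A] P.integrable_const_bound[where B = B]; simp add: bounds)+
  have int_cut: "integrable P (\<lambda>\<omega>. tail_cutoff q (X \<omega>))"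
    by (rule P.integrable_const_bound[where B = 1]) (simp_all add: tail_cutoff_simps)
  have "\<bar>(\<integral>\<omega>. g (X \<omega>) \<partial>P) - (\<integral>\<omega>. h (X \<omega>) \<partial>P)\<bar> = \<bar>\<integral>\<omega>. g (X \<omega>) - h (X \<omega>) \<partial>P\<bar>"
    using int by simp
  also have "\<dots> \<le> (\<integral>\<omega>. \<bar>g (X \<omega>) - h (X \<omega>)\<bar> \<partial>P)"
    by (rule integral_abs_bound)
  also have "\<dots> \<le> (\<integral>\<omega>. e + K * tail_cutoff q (X \<omega>) \<partial>P)"
    using int int_cut close by (intro integral_mono) auto
  also have "\<dots> = e + K * (\<integral>\<omega>. tail_cutoff q (X \<omega>) \<partial>P)"
    using int_cut by (simp add: P.prob_space)
  finally show ?thesis .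
qed

text \<open>Tightness confines the mass of \<open>U\<close> and of all but finitely many \<open>V n\<close> to a ball, up to a small rest. There
  \<open>h\<close> may be replaced by a trigonometric polynomial with almost the same global bound, and the
  expectations of that polynomial converge because the characteristic functions do.\<close>

theorem Levy_continuity_multivariate:
  fixes V :: "nat \<Rightarrow> 'a \<Rightarrow> real ^ 'p::finite" and U :: "'b \<Rightarrow> real ^ 'p"
    and h :: "real ^ 'p \<Rightarrow> real"
  assumes prob: "prob_space M" "prob_space N"
    and meas [measurable]: "\<And>n. V n \<in> borel_measurable M" "U \<in> borel_measurable N"
    and char: "\<And>a. (\<lambda>n. \<integral>\<omega>. cis (a \<bullet> V n \<omega>) \<partial>M) \<longlonglongrightarrow> (\<integral>\<omega>. cis (a \<bullet> U \<omega>) \<partial>N)"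
    and cont: "continuous_on UNIV h" and bound: "\<And>x. \<bar>h x\<bar> \<le> B"
  shows "(\<lambda>n. \<integral>\<omega>. h (V n \<omega>) \<partial>M) \<longlonglongrightarrow> (\<integral>\<omega>. h (U \<omega>) \<partial>N)"
proof (rule metric_LIMSEQ_I)
  fix \<epsilon> :: real assume "0 < \<epsilon>"
  interpret M: prob_space M by fact
  interpret N: prob_space N by fact
  have [measurable]: "h \<in> borel_measurable borel"
    using cont by (rule borel_measurable_continuous_onI)
  have [measurable]: "(tail_cutoff r :: real ^ 'p \<Rightarrow> real) \<in> borel_measurable borel" for r
    by (intro borel_measurable_continuous_onI continuous_on_tail_cutoff)
  have B: "0 \<le> B"
    using bound[of 0] by linarith
  \<comment> \<open>With tail masses below \<open>e\<close>, replacing \<open>h\<close> by the polynomial costs at most \<open>(2 * B + 4) * e\<close>;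
    the cap \<open>1\<close> keeps the polynomial below \<open>B + 1\<close>.\<close>
  define e where "e = min 1 (\<epsilon> / (2 * B + 4) / 4)"
  have e: "0 < e" "e \<le> 1" "(2 * B + 4) * e \<le> \<epsilon> / 4"
  proof -
    have "e \<le> \<epsilon> / (2 * B + 4) / 4"
      by (simp add: e_def)
    then show "(2 * B + 4) * e \<le> \<epsilon> / 4"
      using B by (simp add: field_simps)
  qed (use \<open>0 < \<epsilon>\<close> B in \<open>auto simp: e_def\<close>)
  obtain r1 where r1: "\<forall>\<^sub>F n in sequentially. (\<integral>\<omega>. tail_cutoff r1 (V n \<omega>) \<partial>M) < e"
    using tight_of_char_tendsto[OF prob meas char e(1)] by blast
  obtain r2 where r2: "(\<integral>\<omega>. tail_cutoff r2 (U \<omega>) \<partial>N) < e"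
    using tail_cutoff_expectation_small[OF prob(2) meas(2) e(1)] by blast
  define r where "r = max r1 r2 + 1"
  obtain g where g: "trig_poly (\<lambda>x. complex_of_real (g x))"
    "\<And>x. norm x \<le> r \<Longrightarrow> \<bar>g x - h x\<bar> \<le> e" "\<And>x. \<bar>g x\<bar> \<le> B + e"
    using trig_poly_approximation[OF cont bound e(1)] by metis
  have g_cont: "(\<lambda>x. complex_of_real (g x)) \<in> borel_measurable borel"
    using g(1) by induction (auto simp: cis_conv_exp)
  have g_eq: "g = (\<lambda>x. Re (complex_of_real (g x)))"
    by simp
  have [measurable]: "g \<in> borel_measurable borel"
    by (subst g_eq) (use g_cont in measurable)
  have gh: "\<bar>g x - h x\<bar> \<le> e + (2 * B + 1) * tail_cutoff q x" if "q = r1 \<or> q = r2" for q x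
  proof (cases "norm x \<le> r")
    case True
    have "\<bar>g x - h x\<bar> \<le> e"
      by (rule g(2)[OF True])
    also have "\<dots> \<le> e + (2 * B + 1) * tail_cutoff q x"
      using B by (simp add: tail_cutoff_simps)
    finally show ?thesis .
  next
    case False
    have "q + 1 \<le> norm x"
      using False that by (auto simp: r_def)
    then have "tail_cutoff q x = 1"
      by (rule tail_cutoff_simps)
    then show ?thesis
      using bound[of x] g(3)[of x] e by simp
  qed
  have close: "\<bar>(\<integral>\<omega>. g (X \<omega>) \<partial>P) - (\<integral>\<omega>. h (X \<omega>) \<partial>P)\<bar> \<le> \<epsilon> / 4"
    if "prob_space P" "X \<in> borel_measurable P" "q = r1 \<or> q = r2"
      and small: "(\<integral>\<omega>. tail_cutoff q (X \<omega>) \<partial>P) < e"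
    for P :: "'c measure" and X q
  proof -
    have "\<bar>(\<integral>\<omega>. g (X \<omega>) \<partial>P) - (\<integral>\<omega>. h (X \<omega>) \<partial>P)\<bar>
        \<le> e + (2 * B + 1) * (\<integral>\<omega>. tail_cutoff q (X \<omega>) \<partial>P)"
      using that(1,2) bound g(3) gh[OF that(3)] by (intro expectation_diff_le_tail) auto
    also have "\<dots> \<le> e + (2 * B + 1) * e"
      using B small by (intro add_left_mono mult_left_mono) auto
    also have "\<dots> \<le> (2 * B + 4) * e"
      using e(1) by (simp add: algebra_simps)
    finally show ?thesis
      using e(3) by linarith
  qed
  have "(\<lambda>n. \<integral>\<omega>. complex_of_real (g (V n \<omega>)) \<partial>M) \<longlonglongrightarrow> (\<integral>\<omega>. complex_of_real (g (U \<omega>)) \<partial>N)"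
    using trig_poly_expectation_tendsto[OF prob meas char g(1)] .
  then have "(\<lambda>n. \<integral>\<omega>. g (V n \<omega>) \<partial>M) \<longlonglongrightarrow> (\<integral>\<omega>. g (U \<omega>) \<partial>N)"
    by (simp add: tendsto_of_real_iff)
  then have "\<forall>\<^sub>F n in sequentially. dist (\<integral>\<omega>. g (V n \<omega>) \<partial>M) (\<integral>\<omega>. g (U \<omega>) \<partial>N) < \<epsilon> / 4"
    using \<open>0 < \<epsilon>\<close> by (intro tendstoD) auto
  then have "\<forall>\<^sub>F n in sequentially. dist (\<integral>\<omega>. h (V n \<omega>) \<partial>M) (\<integral>\<omega>. h (U \<omega>) \<partial>N) < \<epsilon>"
    using r1
  proof eventually_elim
    case (elim n)
    have "\<bar>(\<integral>\<omega>. g (V n \<omega>) \<partial>M) - (\<integral>\<omega>. h (V n \<omega>) \<partial>M)\<bar> \<le> \<epsilon> / 4"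
      using elim(2) by (intro close[OF prob(1) meas(1)]) auto
    moreover have "\<bar>(\<integral>\<omega>. g (U \<omega>) \<partial>N) - (\<integral>\<omega>. h (U \<omega>) \<partial>N)\<bar> \<le> \<epsilon> / 4"
      using r2 by (intro close[OF prob(2) meas(2)]) auto
    ultimately show ?case
      using elim(1) \<open>0 < \<epsilon>\<close> unfolding dist_real_def by linarith
  qed
  then show "\<exists>no. \<forall>n\<ge>no. dist (\<integral>\<omega>. h (V n \<omega>) \<partial>M) (\<integral>\<omega>. h (U \<omega>) \<partial>N) < \<epsilon>"
    by (simp add: eventually_sequentially)
qed

section \<open>A central limit theorem for weighted sums\<close>

lemma exp_minus_taylor_bound:
  fixes u :: real
  assumes "0 \<le> u"
  shows "\<bar>exp (- u) - (1 - u)\<bar> \<le> u\<^sup>2"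
proof -
  have "1 - u \<le> exp (- u)"
    using exp_ge_add_one_self[of "- u"] by simp
  moreover have "exp (- u) \<le> 1 - u + u\<^sup>2"
  proof -
    have "exp (- u) * (1 + u) \<le> exp (- u) * exp u"
      using exp_ge_add_one_self[of u] by (intro mult_left_mono) auto
    also have "\<dots> = 1"
      by (simp add: exp_minus)
    also have "1 \<le> (1 - u + u\<^sup>2) * (1 + u)"
      using assms by (simp add: algebra_simps power2_eq_square)
    finally show ?thesis
      using assms by (simp add: mult_le_cancel_right)
  qed
  ultimately show ?thesis by simp
qed

text \<open>Both the characteristic function of \<open>X\<close> and the Gaussian one equal \<open>1 - v * s\<^sup>2 / 2\<close> up to an error
  that is \<open>s\<^sup>2\<close> times a quantity which depends only on a bound \<open>m\<close> for \<open>s\<close> and vanishes with \<open>m\<close>.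
  The factor \<open>s\<^sup>2\<close> matters: it is what makes the errors summable over a triangular array.\<close>

lemma (in prob_space) char_minus_gaussian_bound:
  assumes [measurable]: "random_variable borel X"
    and int: "integrable M X" "integrable M (\<lambda>\<omega>. (X \<omega>)\<^sup>2)"
    and moments: "expectation X = 0" "variance X = v"
    and s: "\<bar>s\<bar> \<le> m"
  shows "cmod (char (distr M borel X) s - exp (- (v * s\<^sup>2 / 2)))
    \<le> s\<^sup>2 * (expectation (\<lambda>\<omega>. min (6 * (X \<omega>)\<^sup>2) (m * \<bar>X \<omega>\<bar> ^ 3)) / 6 + v\<^sup>2 * m\<^sup>2 / 4)"
proof -
  have v: "0 \<le> v"
    using moments(2) by (auto intro: integral_nonneg_AE)
  have int_min: "integrable M (\<lambda>\<omega>. min (6 * (X \<omega>)\<^sup>2) (r * \<bar>X \<omega>\<bar> ^ 3))" if "0 \<le> r" for r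
    by (rule Bochner_Integration.integrable_bound[OF integrable_mult_right[OF int(2), of 6]])
      (use that in \<open>auto simp: min_def\<close>)
  have "cmod (char (distr M borel X) s - (1 - s\<^sup>2 * v / 2))
      \<le> s\<^sup>2 / 6 * expectation (\<lambda>\<omega>. min (6 * (X \<omega>)\<^sup>2) (\<bar>s\<bar> * \<bar>X \<omega>\<bar> ^ 3))"
    using char_approx3'[OF assms(1) int moments refl] by simp
  also have "\<dots> \<le> s\<^sup>2 / 6 * expectation (\<lambda>\<omega>. min (6 * (X \<omega>)\<^sup>2) (m * \<bar>X \<omega>\<bar> ^ 3))"
    using s by (intro mult_left_mono integral_mono int_min min.mono mult_right_mono) auto
  finally have 1: "cmod (char (distr M borel X) s - complex_of_real (1 - s\<^sup>2 * v / 2))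
      \<le> s\<^sup>2 / 6 * expectation (\<lambda>\<omega>. min (6 * (X \<omega>)\<^sup>2) (m * \<bar>X \<omega>\<bar> ^ 3))"
    by simp
  have "cmod (complex_of_real (1 - s\<^sup>2 * v / 2) - complex_of_real (exp (- (v * s\<^sup>2 / 2))))
      = \<bar>exp (- (v * s\<^sup>2 / 2)) - (1 - v * s\<^sup>2 / 2)\<bar>"
    unfolding of_real_diff[symmetric] norm_of_real by (simp add: abs_minus_commute mult.commute)
  also have "\<dots> \<le> (v * s\<^sup>2 / 2)\<^sup>2"
    using v by (intro exp_minus_taylor_bound) simp
  also have "\<dots> = s\<^sup>2 * (v\<^sup>2 * s\<^sup>2 / 4)"
    by (simp add: power2_eq_square)
  also have "\<dots> \<le> s\<^sup>2 * (v\<^sup>2 * m\<^sup>2 / 4)"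
    using power_mono[OF s, of 2] by (intro mult_left_mono divide_right_mono) auto
  finally show ?thesis
    using 1 norm_triangle_ineq[of "char (distr M borel X) s - complex_of_real (1 - s\<^sup>2 * v / 2)"
        "complex_of_real (1 - s\<^sup>2 * v / 2) - complex_of_real (exp (- (v * s\<^sup>2 / 2)))"]
    by (simp add: algebra_simps)
qed

text \<open>The central limit theorem for weighted sums of i.i.d. variables, in terms of characteristic
  functions. The weights must be uniformly negligible and their squares must have a convergent
  sum; then the Lindeberg condition needs no moment above the second. Instead of dividing by the
  variance of the sum, the product of the characteristic functions is compared factor by factor
  with a product of Gaussian ones, which also covers degenerate limits.\<close>

lemma (in prob_space) char_weighted_sum_tendsto:
  fixes X :: "nat \<Rightarrow> 'a \<Rightarrow> real" and s :: "nat \<Rightarrow> nat \<Rightarrow> real"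
  assumes indep: "indep_vars (\<lambda>_. borel) X I"
    and ident: "\<And>k. k \<in> I \<Longrightarrow> distr M borel (X k) = \<mu>"
    and i0: "i0 \<in> I"
    and square: "integrable M (\<lambda>\<omega>. (X i0 \<omega>)\<^sup>2)"
    and moments: "expectation (X i0) = 0" "variance (X i0) = v"
    and K: "\<And>n. finite (K n)" "\<And>n. K n \<subseteq> I"
    and small: "m \<longlonglongrightarrow> 0" "\<forall>\<^sub>F n in sequentially. \<forall>k\<in>K n. \<bar>s n k\<bar> \<le> m n"
    and q: "(\<lambda>n. \<Sum>k\<in>K n. (s n k)\<^sup>2) \<longlonglongrightarrow> q"
  shows "(\<lambda>n. \<integral>\<omega>. cis (\<Sum>k\<in>K n. s n k * X k \<omega>) \<partial>M) \<longlonglongrightarrow> exp (- (v * q / 2))"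
proof -
  have rv: "random_variable borel (X k)" if "k \<in> I" for k
    using indep that by (auto simp: indep_vars_def)
  have v: "0 \<le> v"
    using moments(2) by (auto intro: integral_nonneg_AE)
  note X0 [measurable] = rv[OF i0]
  have int: "integrable M (X i0)"
    using square_integrable_imp_integrable[OF X0 square] .
  define \<eta> where "\<eta> n = expectation (\<lambda>\<omega>. min (6 * (X i0 \<omega>)\<^sup>2) (\<bar>m n\<bar> * \<bar>X i0 \<omega>\<bar> ^ 3)) / 6
      + v\<^sup>2 * \<bar>m n\<bar>\<^sup>2 / 4" for n
  interpret \<mu>: real_distribution \<mu>
    using real_distribution_distr[OF X0] by (simp add: ident[OF i0])
  have prod: "(\<integral>\<omega>. cis (\<Sum>k\<in>K n. s n k * X k \<omega>) \<partial>M) = (\<Prod>k\<in>K n. char \<mu> (s n k))" for n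
  proof -
    have [measurable]: "random_variable borel (X k)" if "k \<in> K n" for k
      using rv K(2) that by blast
    have "(\<integral>\<omega>. cis (\<Sum>k\<in>K n. s n k * X k \<omega>) \<partial>M)
        = char (distr M borel (\<lambda>\<omega>. \<Sum>k\<in>K n. s n k * X k \<omega>)) 1"
      by (simp add: char_def integral_distr cis_conv_exp)
    also have "\<dots> = (\<Prod>k\<in>K n. char (distr M borel (\<lambda>\<omega>. s n k * X k \<omega>)) 1)"
      by (rule char_distr_sum[OF indep_vars_compose2[OF indep_vars_subset[OF indep K(2)]]]) simp
    also have "\<dots> = (\<Prod>k\<in>K n. char \<mu> (s n k))"
    proof (intro prod.cong refl)
      fix k assume k: "k \<in> K n"
      then have [measurable]: "random_variable borel (X k)" and "distr M borel (X k) = \<mu>"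
        using rv ident K(2) by blast+
      then have "char \<mu> (s n k) = char (distr M borel (X k)) (s n k)"
        by simp
      then show "char (distr M borel (\<lambda>\<omega>. s n k * X k \<omega>)) 1 = char \<mu> (s n k)"
        by (simp add: char_def integral_distr)
    qed
    finally show ?thesis .
  qed
  \<comment> \<open>Dominated convergence replaces a third moment: the integrand is at most \<open>6 * (X i0)\<^sup>2\<close>.\<close>
  have "(\<lambda>n. expectation (\<lambda>\<omega>. min (6 * (X i0 \<omega>)\<^sup>2) (\<bar>m n\<bar> * \<bar>X i0 \<omega>\<bar> ^ 3))) \<longlonglongrightarrow> expectation (\<lambda>\<omega>. 0)"
  proof (rule integral_dominated_convergence[where w = "\<lambda>\<omega>. 6 * (X i0 \<omega>)\<^sup>2"])
    show "AE \<omega> in M. (\<lambda>n. min (6 * (X i0 \<omega>)\<^sup>2) (\<bar>m n\<bar> * \<bar>X i0 \<omega>\<bar> ^ 3)) \<longlonglongrightarrow> 0"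
    proof (rule AE_I2)
      fix \<omega>
      have "(\<lambda>n. min (6 * (X i0 \<omega>)\<^sup>2) (\<bar>m n\<bar> * \<bar>X i0 \<omega>\<bar> ^ 3))
          \<longlonglongrightarrow> min (6 * (X i0 \<omega>)\<^sup>2) (\<bar>0\<bar> * \<bar>X i0 \<omega>\<bar> ^ 3)"
        by (intro tendsto_intros small(1))
      then show "(\<lambda>n. min (6 * (X i0 \<omega>)\<^sup>2) (\<bar>m n\<bar> * \<bar>X i0 \<omega>\<bar> ^ 3)) \<longlonglongrightarrow> 0"
        by simp
    qed
  qed (use square in \<open>auto simp: min_def\<close>)
  then have \<eta>: "\<eta> \<longlonglongrightarrow> 0"
    unfolding \<eta>_def using small(1) by (auto intro!: tendsto_eq_intros)
  have "\<forall>\<^sub>F n in sequentially.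
    cmod ((\<integral>\<omega>. cis (\<Sum>k\<in>K n. s n k * X k \<omega>) \<partial>M) - exp (- (v * (\<Sum>k\<in>K n. (s n k)\<^sup>2) / 2)))
      \<le> (\<Sum>k\<in>K n. (s n k)\<^sup>2) * \<eta> n"
    using small(2)
  proof eventually_elim
    case (elim n)
    have "exp (- (v * (\<Sum>k\<in>K n. (s n k)\<^sup>2) / 2)) = exp (\<Sum>k\<in>K n. - (v * (s n k)\<^sup>2 / 2))"
      by (simp add: sum_distrib_left sum_divide_distrib sum_negf)
    also have "\<dots> = (\<Prod>k\<in>K n. exp (- (v * (s n k)\<^sup>2 / 2)))"
      by (rule exp_sum[OF K(1)])
    finally have "(\<integral>\<omega>. cis (\<Sum>k\<in>K n. s n k * X k \<omega>) \<partial>M)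
        - complex_of_real (exp (- (v * (\<Sum>k\<in>K n. (s n k)\<^sup>2) / 2)))
      = (\<Prod>k\<in>K n. char \<mu> (s n k)) - (\<Prod>k\<in>K n. complex_of_real (exp (- (v * (s n k)\<^sup>2 / 2))))"
      unfolding prod by (simp only: of_real_prod)
    also have "cmod \<dots>
        \<le> (\<Sum>k\<in>K n. cmod (char \<mu> (s n k) - complex_of_real (exp (- (v * (s n k)\<^sup>2 / 2)))))"
      using v by (intro norm_prod_diff \<mu>.cmod_char_le_1) (simp add: norm_of_real)
    also have "\<dots> \<le> (\<Sum>k\<in>K n. (s n k)\<^sup>2 * \<eta> n)"
    proof (intro sum_mono)
      fix k assume "k \<in> K n"
      then have "\<bar>s n k\<bar> \<le> \<bar>m n\<bar>"
        using elim by force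
      from char_minus_gaussian_bound[OF X0 int square moments this]
      show "cmod (char \<mu> (s n k) - complex_of_real (exp (- (v * (s n k)\<^sup>2 / 2)))) \<le> (s n k)\<^sup>2 * \<eta> n"
        by (simp add: \<eta>_def ident[OF i0])
    qed
    finally show ?case
      by (simp add: sum_distrib_right)
  qed
  moreover have "(\<lambda>n. (\<Sum>k\<in>K n. (s n k)\<^sup>2) * \<eta> n) \<longlonglongrightarrow> 0"
    using tendsto_mult[OF q \<eta>] by simp
  ultimately have "(\<lambda>n. (\<integral>\<omega>. cis (\<Sum>k\<in>K n. s n k * X k \<omega>) \<partial>M)
      - complex_of_real (exp (- (v * (\<Sum>k\<in>K n. (s n k)\<^sup>2) / 2)))) \<longlonglongrightarrow> 0"
    by (rule Lim_null_comparison)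
  moreover have "(\<lambda>n. complex_of_real (exp (- (v * (\<Sum>k\<in>K n. (s n k)\<^sup>2) / 2))))
      \<longlonglongrightarrow> complex_of_real (exp (- (v * q / 2)))"
    by (intro tendsto_intros q) simp
  ultimately show ?thesis
    using Lim_transform by fastforce
qed

section \<open>Convergence of the score\<close>

lemma gaussian_vector_cis_expectation:
  assumes gauss: "gaussian_vector N 0 \<Sigma> U" and nonneg: "0 \<le> a \<bullet> (\<Sigma> *v a)"
  shows "(\<integral>\<omega>. cis (a \<bullet> U \<omega>) \<partial>N) = exp (- (a \<bullet> (\<Sigma> *v a) / 2))"
proof -
  let ?w = "a \<bullet> (\<Sigma> *v a)"
  have [measurable]: "U \<in> borel_measurable N"
    and law: "distr N borel (\<lambda>\<omega>. a \<bullet> U \<omega>) = normal_law 0 ?w"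
    using gauss by (auto simp: gaussian_vector_def)
  have "(\<integral>\<omega>. cis (a \<bullet> U \<omega>) \<partial>N) = char (distr N borel (\<lambda>\<omega>. a \<bullet> U \<omega>)) 1"
    by (simp add: char_def integral_distr cis_conv_exp)
  also have "\<dots> = char std_normal_distribution (sqrt ?w)"
    unfolding law normal_law_def by (simp add: char_def integral_distr)
  also have "\<dots> = exp (- (?w / 2))"
    using nonneg by (simp add: char_std_normal_distribution)
  finally show ?thesis .
qed

text \<open>The normalised score \<open>n\<^sup>-\<^sup>1\<^sup>/\<^sup>2 X\<^sub>n\<^sup>T e\<close> of the linear model, that is, the random linear term of
  the rescaled least squares criterion.\<close>

definition score :: "(nat \<Rightarrow> real ^ 'p::finite) \<Rightarrow> (nat \<Rightarrow> real) \<Rightarrow> nat \<Rightarrow> real ^ 'p" where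
  "score x e n = (1 / sqrt (real n)) *\<^sub>R (\<Sum>k=1..n. e k *\<^sub>R x k)"

lemma inner_gram_matrix:
  "a \<bullet> (gram_matrix x n *v b) = (\<Sum>k=1..n. (a \<bullet> x k) * (b \<bullet> x k)) / real n"
proof -
  have "a \<bullet> (gram_matrix x n *v b)
      = (\<Sum>i\<in>UNIV. \<Sum>j\<in>UNIV. \<Sum>k=1..n. a $ i * x k $ i * (x k $ j * b $ j) / real n)"
    by (simp add: inner_vec_def matrix_vector_mult_def gram_matrix_def sum_distrib_left
        sum_distrib_right sum_divide_distrib mult_ac)
  also have "\<dots> = (\<Sum>k=1..n. \<Sum>i\<in>UNIV. \<Sum>j\<in>UNIV. a $ i * x k $ i * (x k $ j * b $ j) / real n)"
    by (subst sum.swap[of _ "{1..n}" UNIV]) (intro sum.cong refl sum.swap)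
  also have "\<dots> = (\<Sum>k=1..n. (a \<bullet> x k) * (b \<bullet> x k)) / real n"
    by (simp add: inner_vec_def sum_product sum_divide_distrib mult_ac)
  finally show ?thesis .
qed

text \<open>The functional \<open>a \<bullet> score\<close> is a weighted sum of the noise with weights
  \<open>(a \<bullet> x k) / sqrt n\<close>. Their squares add up to \<open>a \<bullet> (gram_matrix x n *v a)\<close>, which converges
  by the assumption on the Gram matrices, and they are uniformly negligible by the assumption on
  the size of the regressors.\<close>

lemma score_cis_expectation_tendsto:
  fixes x :: "nat \<Rightarrow> real ^ 'p::finite"
  assumes noise: "strong_white_noise M \<epsilon> v"
    and gram: "gram_matrix x \<longlonglongrightarrow> C"
    and negligible: "(\<lambda>n. Max ((\<lambda>k. (norm (x k))\<^sup>2) ` {1..n})) \<in> o(\<lambda>n. real n)"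
  shows "(\<lambda>n. \<integral>\<omega>. cis (a \<bullet> score x (\<lambda>k. \<epsilon> k \<omega>) n) \<partial>M) \<longlonglongrightarrow> exp (- (v * (a \<bullet> (C *v a)) / 2))"
proof -
  interpret prob_space M
    using noise by (simp add: strong_white_noise_def)
  let ?mx = "\<lambda>n. Max ((\<lambda>k. (norm (x k))\<^sup>2) ` {1..n})"
  define m where "m n = norm a * sqrt (?mx n / real n)" for n
  define s where "s n k = (a \<bullet> x k) / sqrt (real n)" for n k
  have "(\<lambda>n. ?mx n / real n) \<longlonglongrightarrow> 0"
    using smalloD_tendsto[OF negligible] .
  then have "(\<lambda>n. norm a * sqrt (?mx n / real n)) \<longlonglongrightarrow> norm a * sqrt 0"
    by (intro tendsto_intros)
  then have m: "m \<longlonglongrightarrow> 0"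
    by (simp add: m_def[abs_def])
  have s_le: "\<bar>s n k\<bar> \<le> m n" if k: "k \<in> {1..n}" for n k
  proof -
    have "norm (x k) \<le> sqrt (?mx n)"
      using k by (intro real_le_rsqrt Max_ge) auto
    then have "\<bar>a \<bullet> x k\<bar> \<le> norm a * sqrt (?mx n)"
      by (meson Cauchy_Schwarz_ineq2 mult_left_mono norm_ge_zero order_trans)
    then show ?thesis
      by (simp add: s_def m_def real_sqrt_divide divide_right_mono)
  qed
  have "(\<lambda>n. a \<bullet> (gram_matrix x n *v a)) \<longlonglongrightarrow> a \<bullet> (C *v a)"
    using gram
    by (auto intro!: tendsto_intros simp: inner_vec_def matrix_vector_mult_def)
  then have q: "(\<lambda>n. \<Sum>k\<in>{1..n}. (s n k)\<^sup>2) \<longlonglongrightarrow> a \<bullet> (C *v a)"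
    by (simp add: inner_gram_matrix s_def power_divide sum_divide_distrib power2_eq_square)
  have "(\<lambda>n. \<integral>\<omega>. cis (\<Sum>k\<in>{1..n}. s n k * \<epsilon> k \<omega>) \<partial>M) \<longlonglongrightarrow> exp (- (v * (a \<bullet> (C *v a)) / 2))"
  proof (rule char_weighted_sum_tendsto)
    show "indep_vars (\<lambda>_. borel) \<epsilon> {1..}" "integrable M (\<lambda>\<omega>. (\<epsilon> 1 \<omega>)\<^sup>2)"
      "expectation (\<epsilon> 1) = 0" "variance (\<epsilon> 1) = v"
      using noise by (auto simp: strong_white_noise_def)
    show "distr M borel (\<epsilon> k) = distr M borel (\<epsilon> 1)" if "k \<in> {1..}" for k
      using noise that unfolding strong_white_noise_def by blast
    show "\<forall>\<^sub>F n in sequentially. \<forall>k\<in>{1..n}. \<bar>s n k\<bar> \<le> m n"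
      using s_le by simp
  qed (use m q in auto)
  moreover have "a \<bullet> score x (\<lambda>k. \<epsilon> k \<omega>) n = (\<Sum>k\<in>{1..n}. s n k * \<epsilon> k \<omega>)" for n \<omega>
    by (simp add: score_def s_def inner_sum_right sum_divide_distrib mult.commute)
  ultimately show ?thesis by simp
qed

section \<open>Minimizers of penalized quadratic functions\<close>

lemma is_minimizer_iff: "is_minimizer F a \<longleftrightarrow> (\<forall>b. F a \<le> (F b :: real))"
  by (auto simp: is_minimizer_def is_arg_min_def not_less)

text \<open>The constant is the minimum of the quadratic form on the unit sphere.\<close>

lemma pos_def_matrix_coercive:
  fixes A :: "real ^ 'p::finite ^ 'p"
  assumes "pos_def_matrix A"
  obtains c where "0 < c" "\<And>v. c * (norm v)\<^sup>2 \<le> v \<bullet> (A *v v)"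
proof -
  let ?S = "sphere 0 1 :: (real ^ 'p) set"
  have "(axis undefined 1 :: real ^ 'p) \<in> ?S"
    by (simp add: norm_axis_1)
  then have "?S \<noteq> {}" by blast
  moreover have "continuous_on ?S (\<lambda>v. v \<bullet> (A *v v))"
    by (intro continuous_intros matrix_vector_mult_linear_continuous_on)
  ultimately obtain a where a: "a \<in> ?S" "\<And>v. v \<in> ?S \<Longrightarrow> a \<bullet> (A *v a) \<le> v \<bullet> (A *v v)"
    using continuous_attains_inf[OF compact_sphere] by blast
  show thesis
  proof
    have "a \<noteq> 0" using a(1) by auto
    then show "0 < a \<bullet> (A *v a)"
      using assms by (simp add: pos_def_matrix_def)
    show "(a \<bullet> (A *v a)) * (norm v)\<^sup>2 \<le> v \<bullet> (A *v v)" for v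
    proof (cases "v = 0")
      case False
      let ?w = "(1 / norm v) *\<^sub>R v"
      have "a \<bullet> (A *v a) \<le> ?w \<bullet> (A *v ?w)"
        using False by (intro a(2)) simp
      also have "\<dots> = v \<bullet> (A *v v) / (norm v)\<^sup>2"
        by (simp add: matrix_vector_mult_scaleR power2_eq_square)
      finally show ?thesis
        using False by (simp add: field_simps)
    qed simp
  qed
qed

text \<open>Compare the minimal value with the value at the midpoint: convexity of \<open>l\<close> and the parallelogram
  identity for the quadratic form leave a surplus of a quarter of the form at \<open>b - a\<close>. This
  strong convexity is what turns closeness of criteria into closeness of their minimizers.\<close>

lemma quadratic_growth_at_minimizer:
  fixes A :: "real ^ 'p::finite ^ 'p"
  assumes conv: "convex_on UNIV l" and min: "is_minimizer (\<lambda>v. l v + v \<bullet> (A *v v)) a"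
  shows "l a + a \<bullet> (A *v a) + (b - a) \<bullet> (A *v (b - a)) / 2 \<le> l b + b \<bullet> (A *v b)"
proof -
  let ?m = "(1 / 2) *\<^sub>R a + (1 / 2) *\<^sub>R b"
  have "l ?m \<le> (1 / 2) * l a + (1 / 2) * l b"
    using convex_onD[OF conv, of "1 / 2" a b] by simp
  moreover have "?m \<bullet> (A *v ?m) = (a \<bullet> (A *v a)) / 2 + (b \<bullet> (A *v b)) / 2 - (b - a) \<bullet> (A *v (b - a)) / 4"
    by (simp add: matrix_vector_right_distrib matrix_vector_mult_scaleR matrix_vector_mult_diff_distrib
        inner_add_left inner_add_right inner_diff_left inner_diff_right field_simps)
  moreover have "l a + a \<bullet> (A *v a) \<le> l ?m + ?m \<bullet> (A *v ?m)"
    using min by (simp add: is_minimizer_iff)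
  ultimately show ?thesis by linarith
qed

text \<open>The growth bound is that of the \<open>\<ell>\<^sup>1\<close> norm in terms of the Euclidean norm. It makes all bounds on
  minimizers below independent of the penalty.\<close>

definition convex_penalty :: "(real ^ 'p::finite \<Rightarrow> real) \<Rightarrow> bool" where
  "convex_penalty P \<longleftrightarrow> convex_on UNIV P \<and> (\<forall>v. \<bar>P v\<bar> \<le> CARD('p) * norm v)"

text \<open>Both the Lasso criterion, recentred at \<open>\<beta>\<close> and rescaled, and the limiting criterion have this
  form; they differ only in the matrix and in the penalty.\<close>

definition penalized_quadratic ::
    "real ^ 'p::finite \<Rightarrow> real ^ 'p ^ 'p \<Rightarrow> (real ^ 'p \<Rightarrow> real) \<Rightarrow> real \<Rightarrow> real ^ 'p \<Rightarrow> real" where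
  "penalized_quadratic u A P t v = (- 2 * (u \<bullet> v) + t * P v) + v \<bullet> (A *v v)"

lemma convex_on_linear_plus_penalty:
  assumes "convex_penalty P" "0 \<le> t"
  shows "convex_on UNIV (\<lambda>v. - 2 * (u \<bullet> v) + t * P v)"
proof (rule convex_on_add)
  show "convex_on UNIV (\<lambda>v. - 2 * (u \<bullet> v))"
    by (simp add: convex_on_def inner_add_right algebra_simps)
  show "convex_on UNIV (\<lambda>v. t * P v)"
    using assms by (intro convex_on_cmul) (auto simp: convex_penalty_def)
qed

lemma penalized_quadratic_growth:
  assumes "convex_penalty P" "0 \<le> t"
    and min: "is_minimizer (penalized_quadratic u A P t) a"
  shows "penalized_quadratic u A P t a + (b - a) \<bullet> (A *v (b - a)) / 2 \<le> penalized_quadratic u A P t b"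
  using quadratic_growth_at_minimizer[OF convex_on_linear_plus_penalty[OF assms(1,2)]
      min[unfolded penalized_quadratic_def]]
  by (simp add: penalized_quadratic_def)

lemma penalized_quadratic_lower_bound:
  fixes u :: "real ^ 'p::finite" and t :: real
  assumes P: "convex_penalty P" and "0 \<le> t" and coercive: "c * (norm v)\<^sup>2 \<le> v \<bullet> (A *v v)"
  shows "norm v * (c * norm v - (2 * norm u + t * CARD('p))) \<le> penalized_quadratic u A P t v"
proof -
  have "\<bar>u \<bullet> v\<bar> \<le> norm u * norm v"
    by (rule Cauchy_Schwarz_ineq2)
  moreover have "- (t * (CARD('p) * norm v)) \<le> t * P v"
    using P \<open>0 \<le> t\<close> mult_left_mono[of "- (CARD('p) * norm v)" "P v" t]
    by (simp add: convex_penalty_def abs_le_iff minus_le_iff)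
  ultimately show ?thesis
    using coercive by (simp add: penalized_quadratic_def algebra_simps power2_eq_square)
qed

lemma penalized_quadratic_zero:
  "convex_penalty P \<Longrightarrow> penalized_quadratic u A P t 0 = 0"
  by (auto simp: penalized_quadratic_def convex_penalty_def dest: spec[of _ 0])

text \<open>Outside this ball the criterion is positive, whereas it vanishes at the origin.\<close>

lemma norm_minimizer_le:
  fixes u :: "real ^ 'p::finite" and t :: real
  assumes P: "convex_penalty P" "0 \<le> t" and "0 < c" and coercive: "\<And>v. c * (norm v)\<^sup>2 \<le> v \<bullet> (A *v v)"
    and min: "is_minimizer (penalized_quadratic u A P t) a"
  shows "norm a \<le> (2 * norm u + t * CARD('p)) / c"
proof (rule ccontr)
  assume "\<not> ?thesis"
  then have *: "0 < c * norm a - (2 * norm u + t * CARD('p))"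
    using \<open>0 < c\<close> by (simp add: field_simps)
  moreover have "0 \<le> 2 * norm u + t * CARD('p)"
    using P(2) by simp
  ultimately have "0 < c * norm a" by linarith
  then have "0 < norm a"
    using \<open>0 < c\<close> by (simp add: zero_less_mult_iff)
  then have "0 < norm a * (c * norm a - (2 * norm u + t * CARD('p)))"
    using * by (intro mult_pos_pos)
  also have "\<dots> \<le> penalized_quadratic u A P t a"
    by (rule penalized_quadratic_lower_bound[OF P coercive])
  also have "\<dots> \<le> penalized_quadratic u A P t 0"
    using min by (simp add: is_minimizer_iff)
  finally show False
    by (simp add: penalized_quadratic_zero[OF P(1)])
qed

lemma ex1_minimizer:
  fixes u :: "real ^ 'p::finite" and t :: real
  assumes P: "convex_penalty P" "0 \<le> t" and "0 < c" and coercive: "\<And>v. c * (norm v)\<^sup>2 \<le> v \<bullet> (A *v v)"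
  shows "\<exists>!a. is_minimizer (penalized_quadratic u A P t) a"
proof -
  let ?F = "penalized_quadratic u A P t"
  define r where "r = (2 * norm u + t * CARD('p)) / c"
  have r: "0 \<le> r"
    using P(2) \<open>0 < c\<close> by (simp add: r_def)
  have "continuous_on UNIV P"
    using P(1) by (intro convex_on_continuous) (auto simp: convex_penalty_def)
  then have "continuous_on (cball 0 r) ?F"
    unfolding penalized_quadratic_def[abs_def]
    by (intro continuous_intros matrix_vector_mult_linear_continuous_on) (auto intro: continuous_on_subset)
  then have "\<exists>a\<in>cball 0 r. \<forall>b\<in>cball 0 r. ?F a \<le> ?F b"
    using r by (intro continuous_attains_inf) auto
  then obtain a where a: "\<And>b. norm b \<le> r \<Longrightarrow> ?F a \<le> ?F b"
    by (metis mem_cball_0)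
  have "?F a \<le> ?F b" for b
  proof (cases "norm b \<le> r")
    case False
    have "?F a \<le> ?F 0"
      using a[of 0] r by simp
    also have "\<dots> = 0"
      by (rule penalized_quadratic_zero[OF P(1)])
    also have "0 \<le> norm b * (c * norm b - (2 * norm u + t * CARD('p)))"
      using False \<open>0 < c\<close> by (intro mult_nonneg_nonneg) (auto simp: r_def field_simps)
    also have "\<dots> \<le> ?F b"
      by (rule penalized_quadratic_lower_bound[OF P coercive])
    finally show ?thesis .
  qed (rule a)
  then have "is_minimizer ?F a"
    by (simp add: is_minimizer_iff)
  moreover have "b = a" if "is_minimizer ?F b" for b
  proof -
    have "c * (norm (b - a))\<^sup>2 \<le> (b - a) \<bullet> (A *v (b - a))"
      by (rule coercive)
    also have "\<dots> \<le> 0"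
      using penalized_quadratic_growth[OF P \<open>is_minimizer ?F a\<close>, of b] that[unfolded is_minimizer_iff, rule_format, of a]
      by simp
    finally show "b = a"
      using \<open>0 < c\<close> by (simp add: mult_le_0_iff)
  qed
  ultimately show ?thesis by blast
qed

text \<open>Adding the growth inequalities of the two criteria at their minimizers cancels everything but
  the linear terms. The constant does not depend on \<open>t\<close>, so \<open>u\<close> determines the whole path
  in a uniformly Lipschitz way.\<close>

lemma minimizer_Lipschitz:
  fixes u :: "real ^ 'p::finite" and t :: real
  assumes P: "convex_penalty P" "0 \<le> t" and c: "0 < c" and coercive: "\<And>v. c * (norm v)\<^sup>2 \<le> v \<bullet> (A *v v)"
    and a: "is_minimizer (penalized_quadratic u A P t) a"
    and b: "is_minimizer (penalized_quadratic w A P t) b"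
  shows "norm (a - b) \<le> 2 / c * norm (u - w)"
proof (cases "a = b")
  case False
  have "c * (norm (a - b))\<^sup>2 \<le> (b - a) \<bullet> (A *v (b - a)) / 2 + (a - b) \<bullet> (A *v (a - b)) / 2"
    using coercive[of "a - b"] coercive[of "b - a"] by (simp add: norm_minus_commute)
  also have "\<dots> \<le> 2 * ((u - w) \<bullet> (a - b))"
    using penalized_quadratic_growth[OF P a, of b] penalized_quadratic_growth[OF P b, of a]
    by (simp add: penalized_quadratic_def inner_diff_left inner_diff_right)
  also have "\<dots> \<le> 2 * (norm (u - w) * norm (a - b))"
    using Cauchy_Schwarz_ineq2[of "u - w" "a - b"] by simp
  finally have "(c * norm (a - b)) * norm (a - b) \<le> (2 * norm (u - w)) * norm (a - b)"
    by (simp add: power2_eq_square mult_ac)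
  then show ?thesis
    using False c by (simp add: field_simps)
qed (use c in simp)

section \<open>The penalty near the true parameter\<close>

text \<open>The directional derivative of the \<open>\<ell>\<^sup>1\<close> norm at \<open>\<beta>\<close> in the direction \<open>v\<close>: the penalty of the
  limiting criterion. Its approximation by a difference quotient is the penalty of the rescaled
  Lasso criterion.\<close>

definition l1_derivative :: "real ^ 'p::finite \<Rightarrow> real ^ 'p \<Rightarrow> real" where
  "l1_derivative \<beta> v =
     (\<Sum>j\<in>UNIV. v $ j * sgn (\<beta> $ j) * of_bool (\<beta> $ j \<noteq> 0) + \<bar>v $ j\<bar> * of_bool (\<beta> $ j = 0))"

definition l1_difference_quotient :: "real ^ 'p::finite \<Rightarrow> real \<Rightarrow> real ^ 'p \<Rightarrow> real" where
  "l1_difference_quotient \<beta> h v = (\<Sum>j\<in>UNIV. \<bar>\<beta> $ j + h * v $ j\<bar> - \<bar>\<beta> $ j\<bar>) / h"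

lemma sum_abs_le_norm:
  fixes v :: "real ^ 'p::finite"
  shows "(\<Sum>j\<in>UNIV. \<bar>v $ j\<bar>) \<le> CARD('p) * norm v"
  using sum_bounded_above[of UNIV "\<lambda>j. \<bar>v $ j\<bar>" "norm v"] component_le_norm_cart[of v] by simp

lemma convex_penalty_sumI:
  fixes p :: "'p::finite \<Rightarrow> real \<Rightarrow> real"
  assumes "\<And>j. convex_on UNIV (p j)" "\<And>j s. \<bar>p j s\<bar> \<le> \<bar>s\<bar>"
  shows "convex_penalty (\<lambda>v. \<Sum>j\<in>UNIV. p j (v $ j))"
  unfolding convex_penalty_def
proof (intro conjI allI)
  show "convex_on UNIV (\<lambda>v. \<Sum>j\<in>UNIV. p j (v $ j))"
    unfolding convex_on_def
  proof (intro conjI ballI allI impI)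
    fix v w :: "real ^ 'p" and a b :: real assume ab: "0 \<le> a" "0 \<le> b" "a + b = 1"
    have "p j ((a *\<^sub>R v + b *\<^sub>R w) $ j) \<le> a * p j (v $ j) + b * p j (w $ j)" for j
      using assms(1)[of j] ab by (simp add: convex_on_def)
    then show "(\<Sum>j\<in>UNIV. p j ((a *\<^sub>R v + b *\<^sub>R w) $ j))
        \<le> a * (\<Sum>j\<in>UNIV. p j (v $ j)) + b * (\<Sum>j\<in>UNIV. p j (w $ j))"
      by (simp only: sum_distrib_left sum.distrib[symmetric]) (rule sum_mono)
  qed simp
  fix v :: "real ^ 'p"
  have "\<bar>\<Sum>j\<in>UNIV. p j (v $ j)\<bar> \<le> (\<Sum>j\<in>UNIV. \<bar>v $ j\<bar>)"
    by (rule order_trans[OF sum_abs sum_mono]) (rule assms(2))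
  then show "\<bar>\<Sum>j\<in>UNIV. p j (v $ j)\<bar> \<le> CARD('p) * norm v"
    using sum_abs_le_norm[of v] by linarith
qed

lemma convex_penalty_l1_derivative: "convex_penalty (l1_derivative \<beta>)"
  unfolding l1_derivative_def[abs_def]
proof (rule convex_penalty_sumI)
  fix j and s :: real
  let ?p = "\<lambda>s. s * sgn (\<beta> $ j) * of_bool (\<beta> $ j \<noteq> 0) + \<bar>s\<bar> * of_bool (\<beta> $ j = 0)"
  show "\<bar>?p s\<bar> \<le> \<bar>s\<bar>"
    by (simp add: abs_mult sgn_if)
  have "convex_on UNIV (abs :: real \<Rightarrow> real)"
    by (auto simp: convex_on_def abs_mult intro!: order_trans[OF abs_triangle_ineq])
  then show "convex_on UNIV ?p"
    by (cases "\<beta> $ j = 0") (auto simp: convex_on_def algebra_simps)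
qed

lemma convex_penalty_l1_difference_quotient:
  assumes "0 < h"
  shows "convex_penalty (l1_difference_quotient \<beta> h)"
  unfolding l1_difference_quotient_def[abs_def] sum_divide_distrib
proof (rule convex_penalty_sumI)
  fix j and s :: real
  let ?p = "\<lambda>s. (\<bar>\<beta> $ j + h * s\<bar> - \<bar>\<beta> $ j\<bar>) / h"
  have "\<bar>\<bar>\<beta> $ j + h * s\<bar> - \<bar>\<beta> $ j\<bar>\<bar> \<le> h * \<bar>s\<bar>"
    using abs_triangle_ineq3[of "\<beta> $ j + h * s" "\<beta> $ j"] assms by (simp add: abs_mult)
  then show "\<bar>?p s\<bar> \<le> \<bar>s\<bar>"
    using assms by (simp add: field_simps)
  show "convex_on UNIV ?p"
    unfolding convex_on_def
  proof (intro conjI ballI allI impI)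
    fix r s a b :: real assume ab: "0 \<le> a" "0 \<le> b" "a + b = 1"
    let ?b = "\<beta> $ j"
    have b: "?b = a * ?b + b * ?b" "\<bar>?b\<bar> = a * \<bar>?b\<bar> + b * \<bar>?b\<bar>"
      using ab(3) by (simp_all add: distrib_right[symmetric])
    have "\<bar>?b + h * (a *\<^sub>R r + b *\<^sub>R s)\<bar> = \<bar>a * (?b + h * r) + b * (?b + h * s)\<bar>"
      by (subst b(1)) (simp add: algebra_simps)
    also have "\<dots> \<le> a * \<bar>?b + h * r\<bar> + b * \<bar>?b + h * s\<bar>"
      using abs_triangle_ineq[of "a * (?b + h * r)" "b * (?b + h * s)"] ab by (simp add: abs_mult)
    finally have "\<bar>?b + h * (a *\<^sub>R r + b *\<^sub>R s)\<bar> - \<bar>?b\<bar>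
        \<le> a * (\<bar>?b + h * r\<bar> - \<bar>?b\<bar>) + b * (\<bar>?b + h * s\<bar> - \<bar>?b\<bar>)"
      using b(2) by (simp add: right_diff_distrib)
    from divide_right_mono[OF this, of h] assms
    show "?p (a *\<^sub>R r + b *\<^sub>R s) \<le> a * ?p r + b * ?p s"
      by (simp add: add_divide_distrib)
  qed simp
qed

text \<open>The \<open>\<ell>\<^sup>1\<close> norm is piecewise linear: as long as no nonzero coordinate of \<open>\<beta>\<close> changes its sign, the
  difference quotient is not merely close to the derivative but equal to it.\<close>

lemma l1_difference_quotient_eq_derivative:
  assumes h: "0 < h" and small: "\<And>j. \<beta> $ j \<noteq> 0 \<Longrightarrow> h * norm v \<le> \<bar>\<beta> $ j\<bar>"
  shows "l1_difference_quotient \<beta> h v = l1_derivative \<beta> v"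
  unfolding l1_difference_quotient_def l1_derivative_def sum_divide_distrib
proof (rule sum.cong[OF refl])
  fix j
  show "(\<bar>\<beta> $ j + h * v $ j\<bar> - \<bar>\<beta> $ j\<bar>) / h
      = v $ j * sgn (\<beta> $ j) * of_bool (\<beta> $ j \<noteq> 0) + \<bar>v $ j\<bar> * of_bool (\<beta> $ j = 0)"
  proof (cases "\<beta> $ j = 0")
    case True
    then show ?thesis
      using h by (simp add: abs_mult)
  next
    case False
    have "\<bar>h * v $ j\<bar> \<le> h * norm v"
      using h component_le_norm_cart[of v j] by (simp add: abs_mult)
    also have "\<dots> \<le> \<bar>\<beta> $ j\<bar>"
      by (rule small[OF False])
    finally have "\<bar>\<beta> $ j + h * v $ j\<bar> - \<bar>\<beta> $ j\<bar> = sgn (\<beta> $ j) * (h * v $ j)"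
      using False by (cases "0 < \<beta> $ j") (auto simp: sgn_if)
    then show ?thesis
      using False h by simp
  qed
qed

section \<open>Stability of the minimizers\<close>

lemma abs_quadratic_form_le:
  fixes A :: "real ^ 'p::finite ^ 'p"
  shows "\<bar>v \<bullet> (A *v v)\<bar> \<le> (\<Sum>i\<in>UNIV. \<Sum>j\<in>UNIV. \<bar>A $ i $ j\<bar>) * (norm v)\<^sup>2"
proof -
  have "norm (A *v v) \<le> onorm ((*v) A) * norm v"
    by (rule onorm) (rule matrix_vector_mul_bounded_linear)
  also have "\<dots> \<le> (\<Sum>i\<in>UNIV. \<Sum>j\<in>UNIV. \<bar>A $ i $ j\<bar>) * norm v"
    by (intro mult_right_mono onorm_le_matrix_component_sum) simp
  finally have "norm v * norm (A *v v) \<le> norm v * ((\<Sum>i\<in>UNIV. \<Sum>j\<in>UNIV. \<bar>A $ i $ j\<bar>) * norm v)"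
    by (rule mult_left_mono) simp
  then show ?thesis
    using Cauchy_Schwarz_ineq2[of v "A *v v"] by (simp add: power2_eq_square mult_ac)
qed

text \<open>Minimizers of both criteria stay in a ball whose radius \<open>B\<close> depends only on \<open>R\<close> and \<open>T\<close>. On that
  ball the penalties coincide once \<open>h n\<close> is small, so the criteria differ only through the
  quadratic form, by at most \<open>\<delta> n * B\<^sup>2\<close>. Quadratic growth turns closeness of the criteria
  into closeness of the minimizers, uniformly in \<open>u\<close> and \<open>t\<close>.\<close>

lemma minimizers_converge_uniformly:
  fixes A :: "nat \<Rightarrow> real ^ 'p::finite ^ 'p"
  assumes A: "A \<longlonglongrightarrow> C" and c: "0 < c" and coercive: "\<And>v. c * (norm v)\<^sup>2 \<le> v \<bullet> (C *v v)"
    and h: "h \<longlonglongrightarrow> 0" "\<forall>\<^sub>F n in sequentially. 0 < h n" and e: "0 < e"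
  shows "\<forall>\<^sub>F n in sequentially. \<forall>u t w z. norm u \<le> R \<longrightarrow> 0 \<le> t \<longrightarrow> t \<le> T \<longrightarrow>
    is_minimizer (penalized_quadratic u (A n) (l1_difference_quotient \<beta> (h n)) t) w \<longrightarrow>
    is_minimizer (penalized_quadratic u C (l1_derivative \<beta>) t) z \<longrightarrow> norm (w - z) < e"
proof -
  define \<delta> where "\<delta> n = (\<Sum>i\<in>UNIV. \<Sum>j\<in>UNIV. \<bar>(C - A n) $ i $ j\<bar>)" for n
  \<comment> \<open>The matrices \<open>A n\<close> are eventually coercive with \<open>c / 2\<close> instead of \<open>c\<close>.\<close>
  define B where "B = (2 * \<bar>R\<bar> + \<bar>T\<bar> * CARD('p)) / (c / 2)"
  have "(\<lambda>n. \<Sum>i\<in>UNIV. \<Sum>j\<in>UNIV. \<bar>(C - A n) $ i $ j\<bar>) \<longlonglongrightarrow> (\<Sum>i\<in>UNIV. \<Sum>j\<in>UNIV. \<bar>(C - C) $ i $ j\<bar>)"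
    by (intro tendsto_intros A)
  then have \<delta>: "\<delta> \<longlonglongrightarrow> 0"
    by (simp add: \<delta>_def[abs_def])
  have \<delta>_form: "\<bar>v \<bullet> (C *v v) - v \<bullet> (A n *v v)\<bar> \<le> \<delta> n * (norm v)\<^sup>2" for n v
    using abs_quadratic_form_le[of v "C - A n"]
    by (simp add: \<delta>_def matrix_vector_mult_diff_rdistrib inner_diff_right)
  have B_le: "(2 * norm u + t * CARD('p)) / (c / 2) \<le> B" if "norm u \<le> R" "0 \<le> t" "t \<le> T" for u :: "real ^ 'p" and t
    unfolding B_def using that c by (intro divide_right_mono add_mono mult_right_mono mult_left_mono) auto
  have "\<forall>\<^sub>F n in sequentially. \<delta> n < c / 2"
    using c by (intro order_tendstoD(2)[OF \<delta>]) simp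
  moreover have "(\<lambda>n. 4 * \<delta> n * B\<^sup>2) \<longlonglongrightarrow> 4 * 0 * B\<^sup>2"
    by (intro tendsto_intros \<delta>)
  then have "\<forall>\<^sub>F n in sequentially. 4 * \<delta> n * B\<^sup>2 < c * e\<^sup>2"
    using c e by (intro order_tendstoD(2)) auto
  moreover have "\<forall>\<^sub>F n in sequentially. \<forall>j\<in>{j. \<beta> $ j \<noteq> 0}. h n * B < \<bar>\<beta> $ j\<bar>"
  proof (intro eventually_ball_finite ballI)
    fix j assume "j \<in> {j. \<beta> $ j \<noteq> 0}"
    moreover have "(\<lambda>n. h n * B) \<longlonglongrightarrow> 0 * B"
      by (intro tendsto_intros h)
    ultimately show "\<forall>\<^sub>F n in sequentially. h n * B < \<bar>\<beta> $ j\<bar>"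
      by (intro order_tendstoD(2)) auto
  qed simp
  ultimately show ?thesis
    using h(2)
  proof eventually_elim
    case (elim n)
    show ?case
    proof (intro allI impI)
      fix u :: "real ^ 'p" and t w z
      assume u: "norm u \<le> R" and t: "0 \<le> t" "t \<le> T"
        and w: "is_minimizer (penalized_quadratic u (A n) (l1_difference_quotient \<beta> (h n)) t) w" (is "is_minimizer ?F w")
        and z: "is_minimizer (penalized_quadratic u C (l1_derivative \<beta>) t) z" (is "is_minimizer ?G z")
      have "(c / 2) * (norm v)\<^sup>2 \<le> v \<bullet> (A n *v v)" for v
      proof -
        have "\<delta> n * (norm v)\<^sup>2 \<le> (c / 2) * (norm v)\<^sup>2"
          using elim(1) by (intro mult_right_mono) auto
        then show ?thesis
          using \<delta>_form[of v n] coercive[of v] by linarith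
      qed
      then have "norm w \<le> (2 * norm u + t * CARD('p)) / (c / 2)"
        using c by (intro norm_minimizer_le[OF convex_penalty_l1_difference_quotient[OF elim(4)] t(1) _ _ w]) auto
      with B_le[OF u t] have wB: "norm w \<le> B" by linarith
      have "(c / 2) * (norm v)\<^sup>2 \<le> v \<bullet> (C *v v)" for v
        using c by (intro order_trans[OF mult_right_mono coercive]) auto
      then have "norm z \<le> (2 * norm u + t * CARD('p)) / (c / 2)"
        using c by (intro norm_minimizer_le[OF convex_penalty_l1_derivative t(1) _ _ z]) auto
      with B_le[OF u t] have zB: "norm z \<le> B" by linarith
      have FG: "\<bar>?F v - ?G v\<bar> \<le> \<delta> n * B\<^sup>2" if v: "norm v \<le> B" for v
      proof -
        have "h n * norm v \<le> h n * B"
          using elim(4) v by (intro mult_left_mono) auto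
        moreover have "h n * B < \<bar>\<beta> $ j\<bar>" if "\<beta> $ j \<noteq> 0" for j
          using elim(3) that by simp
        ultimately have "h n * norm v \<le> \<bar>\<beta> $ j\<bar>" if "\<beta> $ j \<noteq> 0" for j
          using that by (meson less_imp_le order_trans)
        then have "l1_difference_quotient \<beta> (h n) v = l1_derivative \<beta> v"
          by (rule l1_difference_quotient_eq_derivative[OF elim(4)])
        then have "\<bar>?F v - ?G v\<bar> = \<bar>v \<bullet> (C *v v) - v \<bullet> (A n *v v)\<bar>"
          by (simp add: penalized_quadratic_def abs_minus_commute)
        also have "\<dots> \<le> \<delta> n * (norm v)\<^sup>2"
          by (rule \<delta>_form)
        also have "\<dots> \<le> \<delta> n * B\<^sup>2"
          using v by (intro mult_left_mono power_mono) (auto simp: \<delta>_def sum_nonneg)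
        finally show ?thesis .
      qed
      have "c * (norm (w - z))\<^sup>2 / 2 \<le> (w - z) \<bullet> (C *v (w - z)) / 2"
        using coercive[of "w - z"] by simp
      also have "\<dots> \<le> ?G w - ?G z"
        using penalized_quadratic_growth[OF convex_penalty_l1_derivative t(1) z, of w] by simp
      also have "\<dots> \<le> 2 * (\<delta> n * B\<^sup>2)"
        using w[unfolded is_minimizer_iff, rule_format, of z] FG[OF wB] FG[OF zB] by linarith
      also have "\<dots> < c * e\<^sup>2 / 2"
        using elim(2) by simp
      finally have "(norm (w - z))\<^sup>2 < e\<^sup>2"
        using c by simp
      then show "norm (w - z) < e"
        by (rule power2_less_imp_less) (use e in simp)
    qed
  qed
qed

section \<open>The Lasso criterion in the local parameter\<close>

text \<open>In the local parameter \<open>v = sqrt n *\<^sub>R (\<phi> - \<beta>)\<close> the residual sum of squares becomes quadratic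
  with the score as linear term. The rate \<open>lam n = 1 / sqrt n\<close> is exactly the one for which
  the penalty contributes at the same order \<open>1 / n\<close>.\<close>

lemma lasso_objective_expansion:
  fixes x :: "nat \<Rightarrow> real ^ 'p::finite"
  assumes n: "n \<ge> 1" and lam: "lam n = real n powr (- 1 / 2)"
    and y: "\<And>k. k \<in> {1..n} \<Longrightarrow> y k = x k \<bullet> \<beta> + e k"
  defines "h \<equiv> 1 / sqrt (real n)"
  shows "lasso_objective x y lam n (\<beta> + h *\<^sub>R v) t = lasso_objective x y lam n \<beta> t
    + (1 / real n) * penalized_quadratic (score x e n) (gram_matrix x n) (l1_difference_quotient \<beta> h) t v"
proof -
  have h: "0 < h" "h * h = 1 / real n"
    using n by (simp_all add: h_def)
  have lam_h: "lam n = h"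
    using n by (simp add: lam h_def powr_minus_divide powr_half_sqrt)
  have "(\<Sum>k=1..n. (y k - x k \<bullet> (\<beta> + h *\<^sub>R v))\<^sup>2) = (\<Sum>k=1..n. (e k - h * (x k \<bullet> v))\<^sup>2)"
    by (intro sum.cong refl) (simp add: y inner_add_right algebra_simps)
  also have "\<dots> = (\<Sum>k=1..n. (e k)\<^sup>2 - 2 * h * (e k * (x k \<bullet> v)) + (h * h) * (x k \<bullet> v)\<^sup>2)"
    by (intro sum.cong refl) (simp add: power2_eq_square algebra_simps)
  also have "\<dots> = (\<Sum>k=1..n. (e k)\<^sup>2) - 2 * (h * (\<Sum>k=1..n. e k * (x k \<bullet> v))) + (h * h) * (\<Sum>k=1..n. (x k \<bullet> v)\<^sup>2)"
    by (simp add: sum.distrib sum_subtractf sum_distrib_left mult_ac)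
  also have "(\<Sum>k=1..n. (e k)\<^sup>2) = (\<Sum>k=1..n. (y k - x k \<bullet> \<beta>)\<^sup>2)"
    by (intro sum.cong refl) (simp add: y)
  also have "h * (\<Sum>k=1..n. e k * (x k \<bullet> v)) = score x e n \<bullet> v"
    by (simp add: score_def h_def inner_sum_left)
  also have "(h * h) * (\<Sum>k=1..n. (x k \<bullet> v)\<^sup>2) = v \<bullet> (gram_matrix x n *v v)"
    unfolding h(2) inner_gram_matrix by (simp add: inner_commute power2_eq_square)
  finally have rss: "(\<Sum>k=1..n. (y k - x k \<bullet> (\<beta> + h *\<^sub>R v))\<^sup>2)
    = (\<Sum>k=1..n. (y k - x k \<bullet> \<beta>)\<^sup>2) - 2 * (score x e n \<bullet> v) + v \<bullet> (gram_matrix x n *v v)"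
    by (simp add: mult.assoc)
  have "(\<Sum>i\<in>UNIV. \<bar>(\<beta> + h *\<^sub>R v) $ i\<bar>) = (\<Sum>i\<in>UNIV. \<bar>\<beta> $ i\<bar>) + h * l1_difference_quotient \<beta> h v"
    using h(1) by (simp add: l1_difference_quotient_def sum_subtractf)
  then have "t * lam n * (\<Sum>i\<in>UNIV. \<bar>(\<beta> + h *\<^sub>R v) $ i\<bar>)
      = t * lam n * (\<Sum>i\<in>UNIV. \<bar>\<beta> $ i\<bar>) + t * ((h * h) * l1_difference_quotient \<beta> h v)"
    by (simp add: lam_h algebra_simps)
  then show ?thesis
    unfolding lasso_objective_def rss h(2) penalized_quadratic_def by (simp add: algebra_simps add_divide_distrib diff_divide_distrib)
qed

lemma lasso_minimizer_rescaled:
  fixes x :: "nat \<Rightarrow> real ^ 'p::finite"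
  assumes n: "n \<ge> 1" and lam: "lam n = real n powr (- 1 / 2)"
    and y: "\<And>k. k \<in> {1..n} \<Longrightarrow> y k = x k \<bullet> \<beta> + e k"
    and min: "is_minimizer (\<lambda>\<phi>. lasso_objective x y lam n \<phi> t) b"
  shows "is_minimizer
    (penalized_quadratic (score x e n) (gram_matrix x n) (l1_difference_quotient \<beta> (1 / sqrt (real n))) t)
    (sqrt (real n) *\<^sub>R (b - \<beta>))"
  unfolding is_minimizer_iff
proof
  fix v
  let ?F = "penalized_quadratic (score x e n) (gram_matrix x n) (l1_difference_quotient \<beta> (1 / sqrt (real n))) t"
  let ?L = "\<lambda>\<phi>. lasso_objective x y lam n \<phi> t"
  let ?w = "sqrt (real n) *\<^sub>R (b - \<beta>)"
  note expansion = lasso_objective_expansion[where x = x and lam = lam and n = n and y = y and \<beta> = \<beta> and e = e and t = t, OF n lam y]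
  have "?L (\<beta> + (1 / sqrt (real n)) *\<^sub>R ?w) \<le> ?L (\<beta> + (1 / sqrt (real n)) *\<^sub>R v)"
    using min n by (simp add: is_minimizer_iff)
  then have "(1 / real n) * ?F ?w \<le> (1 / real n) * ?F v"
    by (simp only: expansion add_le_cancel_left)
  then show "?F ?w \<le> ?F v"
    using n by (simp add: divide_le_cancel)
qed

text \<open>The least squares solution \<open>b0\<close> has the smallest residual sum of squares, so \<open>b\<close> can win against
  it only through a smaller penalty.\<close>

lemma lasso_path_l1_le:
  assumes "0 < t" "0 < lam n"
    and b0: "is_minimizer (\<lambda>\<phi>. lasso_objective x y lam n \<phi> 0) b0"
    and b: "is_minimizer (\<lambda>\<phi>. lasso_objective x y lam n \<phi> t) b"
  shows "(\<Sum>i\<in>UNIV. \<bar>b $ i\<bar>) \<le> (\<Sum>i\<in>UNIV. \<bar>b0 $ i\<bar>)"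
proof -
  have "lasso_objective x y lam n b0 0 \<le> lasso_objective x y lam n b 0"
    "lasso_objective x y lam n b t \<le> lasso_objective x y lam n b0 t"
    using b0 b by (simp_all add: is_minimizer_iff)
  then have "(t * lam n) * (\<Sum>i\<in>UNIV. \<bar>b $ i\<bar>) \<le> (t * lam n) * (\<Sum>i\<in>UNIV. \<bar>b0 $ i\<bar>)"
    unfolding lasso_objective_def by linarith
  then show ?thesis
    using assms(1,2) by simp
qed

section \<open>Continuous functions for locally uniform convergence\<close>

lemma loc_bounded_funsI:
  assumes "f \<in> extensional {0..}" "\<And>t. 0 \<le> t \<Longrightarrow> norm (f t) \<le> a + b * t" "0 \<le> b"
  shows "f \<in> loc_bounded_funs"
  unfolding loc_bounded_funs_def
proof (intro CollectI conjI allI impI assms(1))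
  fix t :: real assume "0 \<le> t"
  have "norm (f s) \<le> a + b * (t + 1)" if "s \<in> {0..} \<inter> ball t 1" for s
  proof -
    have "s \<le> t + 1"
      using that by (auto simp: dist_real_def)
    then have "a + b * s \<le> a + b * (t + 1)"
      using assms(3) by (intro add_left_mono mult_left_mono)
    then show ?thesis
      using assms(2)[of s] that by simp
  qed
  then have "bounded (f ` ({0..} \<inter> ball t 1))"
    unfolding bounded_iff by blast
  then show "\<exists>e>0. bounded (f ` ({0..} \<inter> ball t e))"
    using zero_less_one by blast
qed

text \<open>The strict uniform ball \<open>{g. \<forall>t\<in>K. dist (g t) (h t) < e}\<close> need not be open, since the
  supremum over \<open>K\<close> may equal \<open>e\<close> without being attained; hence the intermediate radius \<open>d\<close>.\<close>

lemma openin_uniform_nbhd: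
  assumes "compact K" "K \<subseteq> {0..}"
  shows "openin loc_unif_topology {g \<in> loc_bounded_funs. \<exists>d<e. \<forall>t\<in>K. dist (g t) (h t) \<le> d}"
  unfolding openin_loc_unif_topology
proof (intro conjI ballI)
  fix g assume "g \<in> {g \<in> loc_bounded_funs. \<exists>d<e. \<forall>t\<in>K. dist (g t) (h t) \<le> d}"
  then obtain d where d: "d < e" "\<And>t. t \<in> K \<Longrightarrow> dist (g t) (h t) \<le> d"
    by blast
  have "dist (g' t) (h t) \<le> (d + e) / 2"
    if "\<forall>t\<in>K. dist (g' t) (g t) < (e - d) / 2" "t \<in> K" for g' t
    using that d(2)[OF that(2)] dist_triangle[of "g' t" "h t" "g t"] by (auto simp: field_simps dest!: bspec)
  then show "\<exists>L r. compact L \<and> L \<subseteq> {0..} \<and> r > 0 \<and> (\<forall>g'\<in>loc_bounded_funs.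
      (\<forall>t\<in>L. dist (g' t) (g t) < r) \<longrightarrow> g' \<in> {g \<in> loc_bounded_funs. \<exists>d<e. \<forall>t\<in>K. dist (g t) (h t) \<le> d})"
    using assms d(1) by (intro exI[of _ K] exI[of _ "(e - d) / 2"]) (auto intro!: exI[of _ "(d + e) / 2"])
qed auto

text \<open>A continuous function is uniformly continuous around a compact set, with a single compact set
  \<open>K\<close> of times for the comparison: take a finite subcover by neighbourhoods of half the radius,
  unite the sets of times and take the smallest half radius.\<close>

lemma continuous_map_loc_unif_uniform_on_compact:
  assumes f: "continuous_map loc_unif_topology euclideanreal f"
    and Z: "compactin loc_unif_topology Z" and e: "0 < e"
  obtains K d where "compact K" "K \<subseteq> {0..}" "0 < d"
    "\<And>g h. h \<in> Z \<Longrightarrow> g \<in> loc_bounded_funs \<Longrightarrow> \<forall>t\<in>K. dist (g t) (h t) < d \<Longrightarrow> \<bar>f g - f h\<bar> < e"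
proof -
  have Zsub: "Z \<subseteq> loc_bounded_funs"
    using compactin_subset_topspace[OF Z] by simp
  have "\<exists>K d. compact K \<and> K \<subseteq> {0..} \<and> 0 < d \<and>
      (\<forall>g\<in>loc_bounded_funs. (\<forall>t\<in>K. dist (g t) (h t) < d) \<longrightarrow> \<bar>f g - f h\<bar> < e / 2)" if h: "h \<in> Z" for h
  proof -
    have "openin loc_unif_topology {g \<in> topspace loc_unif_topology. f g \<in> ball (f h) (e / 2)}"
      using f by (rule openin_continuous_map_preimage) simp
    moreover have "h \<in> {g \<in> topspace loc_unif_topology. f g \<in> ball (f h) (e / 2)}"
      using h Zsub e by auto
    ultimately show ?thesis
      unfolding openin_loc_unif_topology by (fastforce simp: dist_real_def abs_minus_commute)
  qed
  then obtain K d where Kd: "\<And>h. h \<in> Z \<Longrightarrow> compact (K h)" "\<And>h. h \<in> Z \<Longrightarrow> K h \<subseteq> {0..}"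
    "\<And>h. h \<in> Z \<Longrightarrow> 0 < d h"
    "\<And>h g. h \<in> Z \<Longrightarrow> g \<in> loc_bounded_funs \<Longrightarrow> \<forall>t\<in>K h. dist (g t) (h t) < d h \<Longrightarrow> \<bar>f g - f h\<bar> < e / 2"
    by metis
  define O' where "O' h = {g \<in> loc_bounded_funs. \<exists>r<d h / 2. \<forall>t\<in>K h. dist (g t) (h t) \<le> r}" for h
  have "\<And>V. V \<in> O' ` Z \<Longrightarrow> openin loc_unif_topology V"
    using Kd openin_uniform_nbhd unfolding O'_def by fast
  moreover have "h \<in> O' h" if "h \<in> Z" for h
    using that Zsub Kd(3)[OF that] by (auto simp: O'_def intro!: exI[of _ 0])
  then have "Z \<subseteq> \<Union>(O' ` Z)" by blast
  ultimately obtain \<F> where "finite \<F>" "\<F> \<subseteq> O' ` Z" "Z \<subseteq> \<Union>\<F>"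
    using Z unfolding compactin_def by meson
  then obtain Y where Y: "finite Y" "Y \<subseteq> Z" "Z \<subseteq> \<Union>(O' ` Y)"
    by (metis finite_subset_image)
  define r where "r = Min (insert 1 ((\<lambda>h. d h / 2) ` Y))"
  have r: "0 < r"
    using Y Kd(3) by (auto simp: r_def)
  have r_le: "r \<le> d h / 2" if "h \<in> Y" for h
    unfolding r_def by (rule Min_le) (use Y(1) that in auto)
  show thesis
  proof
    show "compact (\<Union>(K ` Y))"
      using Y Kd(1) by (intro compact_UN) auto
    show "\<Union>(K ` Y) \<subseteq> {0..}"
      using Y Kd(2) by blast
    show "0 < r" by (rule r)
    fix g h assume h: "h \<in> Z" and g: "g \<in> loc_bounded_funs" and close: "\<forall>t\<in>\<Union>(K ` Y). dist (g t) (h t) < r"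
    obtain k where k: "k \<in> Y" "h \<in> O' k"
      using h Y(3) by blast
    have kZ: "k \<in> Z" using k(1) Y(2) by blast
    obtain q where q: "q < d k / 2" "\<And>t. t \<in> K k \<Longrightarrow> dist (h t) (k t) \<le> q"
      using k(2) by (auto simp: O'_def)
    have "dist (g t) (k t) < d k" if "t \<in> K k" for t
    proof -
      have "dist (g t) (h t) < r"
        using close k(1) that by blast
      then show ?thesis
        using r_le[OF k(1)] q(1) q(2)[OF that] dist_triangle[of "g t" "k t" "h t"] by linarith
    qed
    then have "\<bar>f g - f k\<bar> < e / 2"
      using Kd(4)[OF kZ g] by blast
    moreover have "dist (h t) (k t) < d k" if "t \<in> K k" for t
      using q(2)[OF that] q(1) Kd(3)[OF kZ] by linarith
    then have "\<bar>f h - f k\<bar> < e / 2"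
      using Kd(4)[OF kZ] h Zsub by blast
    ultimately show "\<bar>f g - f h\<bar> < e" by linarith
  qed
qed

section \<open>Weak convergence of nonmeasurable maps near a continuous image\<close>

text \<open>Outer expectations of possibly nonmeasurable \<open>Z\<close> are controlled by measurable functions on both
  sides: \<open>W + V\<close> is a majorant of \<open>Z\<close>, and every majorant of \<open>Z\<close> lies above \<open>W - V\<close>.\<close>

lemma outer_expectation_close:
  assumes prob: "prob_space M" and int: "integrable M W" "integrable M V"
    and close: "\<And>\<omega>. \<omega> \<in> space M \<Longrightarrow> \<bar>Z \<omega> - W \<omega>\<bar> \<le> V \<omega>"
  shows "\<bar>outer_expectation M Z - integral\<^sup>L M W\<bar> \<le> integral\<^sup>L M V"
proof -
  let ?S = "{integral\<^sup>L M V' | V'. integrable M V' \<and> (\<forall>\<omega>\<in>space M. Z \<omega> \<le> V' \<omega>)}"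
  have mem: "integral\<^sup>L M W + integral\<^sup>L M V \<in> ?S"
    using int close by (auto intro!: exI[of _ "\<lambda>\<omega>. W \<omega> + V \<omega>"] simp: abs_le_iff algebra_simps)
  have lower: "integral\<^sup>L M W - integral\<^sup>L M V \<le> s" if s: "s \<in> ?S" for s
  proof -
    obtain V' where V': "s = integral\<^sup>L M V'" "integrable M V'" "\<And>\<omega>. \<omega> \<in> space M \<Longrightarrow> Z \<omega> \<le> V' \<omega>"
      using s by blast
    have "integral\<^sup>L M (\<lambda>\<omega>. W \<omega> - V \<omega>) \<le> integral\<^sup>L M V'"
    proof (rule integral_mono)
      show "W \<omega> - V \<omega> \<le> V' \<omega>" if "\<omega> \<in> space M" for \<omega>
        using V'(3)[OF that] close[OF that] by linarith
    qed (use int V' in auto)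
    then show ?thesis
      using int V' by simp
  qed
  have "Inf ?S \<le> integral\<^sup>L M W + integral\<^sup>L M V"
    by (rule cInf_lower[OF mem]) (use lower in \<open>auto simp: bdd_below_def\<close>)
  moreover have "integral\<^sup>L M W - integral\<^sup>L M V \<le> Inf ?S"
    by (rule cInf_greatest) (use mem lower in auto)
  ultimately show ?thesis
    unfolding outer_expectation_def by (simp add: abs_le_iff)
qed

text \<open>A continuous mapping theorem combined with Slutsky's lemma: \<open>X n\<close> may be nonmeasurable, but it
  is uniformly close on compact sets of times to a continuous image \<open>\<Phi> (W n)\<close> of a convergent
  random vector. Since \<open>\<Phi>\<close> maps balls to compact sets of functions, a continuous test function
  barely distinguishes the two when \<open>W n\<close> lies in a ball, and tightness of \<open>W n\<close> bounds the
  contribution of the rest. For \<open>\<Phi> (W n)\<close> itself the claim is finite-dimensional.\<close>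

lemma weakly_convergesI_continuous_image:
  fixes W :: "nat \<Rightarrow> 'a \<Rightarrow> real ^ 'p::finite" and U :: "'b \<Rightarrow> real ^ 'p"
    and \<Phi> :: "real ^ 'p \<Rightarrow> real \<Rightarrow> 'v::real_normed_vector"
  assumes prob: "prob_space M" "prob_space N"
    and meas [measurable]: "\<And>n. W n \<in> borel_measurable M" "U \<in> borel_measurable N"
    and char: "\<And>a. (\<lambda>n. \<integral>\<omega>. cis (a \<bullet> W n \<omega>) \<partial>M) \<longlonglongrightarrow> (\<integral>\<omega>. cis (a \<bullet> U \<omega>) \<partial>N)"
    and \<Phi>: "continuous_map euclidean loc_unif_topology \<Phi>"
    and X: "\<And>n \<omega>. \<omega> \<in> space M \<Longrightarrow> X n \<omega> \<in> loc_bounded_funs"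
    and close: "\<And>R T d. 0 < d \<Longrightarrow> \<forall>\<^sub>F n in sequentially. \<forall>\<omega>\<in>space M. norm (W n \<omega>) \<le> R \<longrightarrow>
        (\<forall>t\<in>{0..T}. dist (X n \<omega> t) (\<Phi> (W n \<omega>) t) < d)"
  shows "weakly_converges loc_unif_topology M X N (\<lambda>\<omega>. \<Phi> (U \<omega>))"
  unfolding weakly_converges_def
proof (intro conjI allI impI)
  interpret M: prob_space M by fact
  interpret N: prob_space N by fact
  have \<Phi>_mem: "\<Phi> u \<in> loc_bounded_funs" for u
    using continuous_map_image_subset_topspace[OF \<Phi>] by auto
  show "X n \<in> space M \<rightarrow> topspace loc_unif_topology" for n
    using X by simp
  show "(\<lambda>\<omega>. \<Phi> (U \<omega>)) \<in> measurable N (borel_of_topology loc_unif_topology)"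
    unfolding borel_of_topology_def
  proof (rule measurable_sigma_sets)
    fix G :: "(real \<Rightarrow> 'v) set" assume "G \<in> {U. openin loc_unif_topology U}"
    then have "open {u. \<Phi> u \<in> G}"
      using openin_continuous_map_preimage[OF \<Phi>, of G] by simp
    then have "U -` {u. \<Phi> u \<in> G} \<inter> space N \<in> sets N"
      by (intro measurable_sets[OF meas(2)]) auto
    then show "(\<lambda>\<omega>. \<Phi> (U \<omega>)) -` G \<inter> space N \<in> sets N"
      by (simp add: vimage_def)
  next
    show "sets (sigma (topspace loc_unif_topology :: (real \<Rightarrow> 'v) set) {U. openin loc_unif_topology U})
       = sigma_sets (topspace loc_unif_topology) {U. openin loc_unif_topology U}"
      using openin_subset by (intro sets_measure_of) blast
  next
    show "{U. openin loc_unif_topology U} \<subseteq> Pow (topspace loc_unif_topology :: (real \<Rightarrow> 'v) set)"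
      using openin_subset by blast
  next
    show "(\<lambda>\<omega>. \<Phi> (U \<omega>)) \<in> space N \<rightarrow> topspace loc_unif_topology"
      using \<Phi>_mem by simp
  qed
  fix f :: "(real \<Rightarrow> 'v) \<Rightarrow> real"
  assume "continuous_map loc_unif_topology euclideanreal f \<and> bounded (f ` topspace loc_unif_topology)"
  then have f: "continuous_map loc_unif_topology euclideanreal f" and
    "bounded (f ` (loc_bounded_funs :: (real \<Rightarrow> 'v) set))" by simp_all
  then obtain B where B: "0 < B" "\<And>g. g \<in> loc_bounded_funs \<Longrightarrow> \<bar>f g\<bar> \<le> B"
    unfolding bounded_pos by auto
  define h where "h u = f (\<Phi> u)" for u
  have h_cont: "continuous_on UNIV h"
    using continuous_map_compose[OF \<Phi> f] by (simp add: h_def[abs_def] o_def)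
  have h_bound: "\<bar>h u\<bar> \<le> B" for u
    by (simp add: h_def B(2) \<Phi>_mem)
  have [measurable]: "h \<in> borel_measurable borel"
    using h_cont by (rule borel_measurable_continuous_onI)
  have [measurable]: "(tail_cutoff r :: real ^ 'p \<Rightarrow> real) \<in> borel_measurable borel" for r
    by (intro borel_measurable_continuous_onI continuous_on_tail_cutoff)
  have h_lim: "(\<lambda>n. \<integral>\<omega>. h (W n \<omega>) \<partial>M) \<longlonglongrightarrow> (\<integral>\<omega>. h (U \<omega>) \<partial>N)"
    by (rule Levy_continuity_multivariate[OF prob meas char h_cont h_bound])
  have "(\<lambda>n. outer_expectation M (\<lambda>\<omega>. f (X n \<omega>)) - (\<integral>\<omega>. h (W n \<omega>) \<partial>M)) \<longlonglongrightarrow> 0"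
  proof (rule LIMSEQ_I)
    fix \<epsilon> :: real assume "0 < \<epsilon>"
    define e where "e = \<epsilon> / 2 / (1 + 2 * B)"
    have e: "0 < e"
      using \<open>0 < \<epsilon>\<close> B(1) by (simp add: e_def)
    have e_eq: "e * (1 + 2 * B) = \<epsilon> / 2"
      by (rule iffD1[OF nonzero_eq_divide_eq e_def]) (use B(1) in simp)
    obtain r where r: "\<forall>\<^sub>F n in sequentially. (\<integral>\<omega>. tail_cutoff r (W n \<omega>) \<partial>M) < e"
      using tight_of_char_tendsto[OF prob meas char e] by blast
    have "compactin loc_unif_topology (\<Phi> ` cball 0 (r + 1))"
      by (rule image_compactin[OF _ \<Phi>]) simp
    then obtain K d where K: "compact K" "K \<subseteq> {0..}" "0 < d"
      "\<And>g h. h \<in> \<Phi> ` cball 0 (r + 1) \<Longrightarrow> g \<in> loc_bounded_funs \<Longrightarrow> \<forall>t\<in>K. dist (g t) (h t) < d \<Longrightarrow> \<bar>f g - f h\<bar> < e"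
      using continuous_map_loc_unif_uniform_on_compact[OF f _ e] by metis
    obtain T where T: "K \<subseteq> {0..T}"
    proof -
      obtain T where "\<forall>t\<in>K. norm t \<le> T"
        using compact_imp_bounded[OF K(1)] by (auto simp: bounded_iff)
      then have "K \<subseteq> {0..T}"
        using K(2) by fastforce
      then show thesis
        by (rule that)
    qed
    have "\<forall>\<^sub>F n in sequentially. \<bar>outer_expectation M (\<lambda>\<omega>. f (X n \<omega>)) - (\<integral>\<omega>. h (W n \<omega>) \<partial>M)\<bar> < \<epsilon>"
      using r close[OF K(3), of "r + 1" T]
    proof eventually_elim
      case (elim n)
      have int: "integrable M (\<lambda>\<omega>. h (W n \<omega>))" "integrable M (\<lambda>\<omega>. tail_cutoff r (W n \<omega>))"
        by (rule M.integrable_const_bound[where B = B] M.integrable_const_bound[where B = 1];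
            simp add: h_bound tail_cutoff_simps)+
      have "\<bar>outer_expectation M (\<lambda>\<omega>. f (X n \<omega>)) - (\<integral>\<omega>. h (W n \<omega>) \<partial>M)\<bar>
          \<le> (\<integral>\<omega>. e + 2 * B * tail_cutoff r (W n \<omega>) \<partial>M)"
      proof (rule outer_expectation_close[OF prob(1)])
        fix \<omega> assume \<omega>: "\<omega> \<in> space M"
        show "\<bar>f (X n \<omega>) - h (W n \<omega>)\<bar> \<le> e + 2 * B * tail_cutoff r (W n \<omega>)"
        proof (cases "norm (W n \<omega>) \<le> r + 1")
          case True
          have "\<forall>t\<in>K. dist (X n \<omega> t) (\<Phi> (W n \<omega>) t) < d"
            using elim(2) \<omega> True T by blast
          moreover have "\<Phi> (W n \<omega>) \<in> \<Phi> ` cball 0 (r + 1)"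
            using True by simp
          ultimately have "\<bar>f (X n \<omega>) - h (W n \<omega>)\<bar> < e"
            unfolding h_def by (intro K(4)[OF _ X[OF \<omega>]])
          moreover have "0 \<le> 2 * B * tail_cutoff r (W n \<omega>)"
            using B(1) by (simp add: tail_cutoff_simps)
          ultimately show ?thesis by linarith
        next
          case False
          then have "tail_cutoff r (W n \<omega>) = 1"
            by (simp add: tail_cutoff_simps)
          then show ?thesis
            using B(2)[OF X[OF \<omega>, of n]] h_bound[of "W n \<omega>"] e by simp
        qed
      qed (use int in auto)
      also have "\<dots> = e + 2 * B * (\<integral>\<omega>. tail_cutoff r (W n \<omega>) \<partial>M)"
        using int by (simp add: M.prob_space)
      also have "\<dots> \<le> e + 2 * B * e"
        using elim(1) B(1) by (intro add_left_mono mult_left_mono) auto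
      also have "\<dots> < \<epsilon>"
        using e_eq \<open>0 < \<epsilon>\<close> by (simp add: algebra_simps)
      finally show ?case .
    qed
    then show "\<exists>no. \<forall>n\<ge>no. norm (outer_expectation M (\<lambda>\<omega>. f (X n \<omega>)) - (\<integral>\<omega>. h (W n \<omega>) \<partial>M) - 0) < \<epsilon>"
      by (simp add: eventually_sequentially)
  qed
  from tendsto_add[OF this h_lim]
  show "(\<lambda>n. outer_expectation M (\<lambda>\<omega>. f (X n \<omega>))) \<longlonglongrightarrow> (\<integral>\<omega>. f (\<Phi> (U \<omega>)) \<partial>N)"
    by (simp add: h_def)
qed

section \<open>Convergence of the Lasso path\<close>

lemma limit_objective_eq:
  "limit_objective C \<beta> u \<phi> t = penalized_quadratic u C (l1_derivative \<beta>) t \<phi>"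
  by (simp add: limit_objective_def penalized_quadratic_def l1_derivative_def)

lemma limit_minimizer_is_minimizer:
  assumes "0 < c" "\<And>v. c * (norm v)\<^sup>2 \<le> v \<bullet> (C *v v)" "0 \<le> t"
  shows "is_minimizer (penalized_quadratic u C (l1_derivative \<beta>) t) (limit_minimizer C \<beta> u t)"
  unfolding limit_minimizer_def limit_objective_eq
  by (rule theI'[OF ex1_minimizer[OF convex_penalty_l1_derivative assms(3,1,2)]])

text \<open>Sharing a Lipschitz constant in \<open>u\<close> for all \<open>t\<close> makes the path depend continuously on \<open>u\<close> even
  in the topology of uniform convergence on the whole half-line. The path is locally bounded
  because its norm grows at most linearly in \<open>t\<close>.\<close>

lemma continuous_map_limit_minimizer:
  fixes C :: "real ^ 'p::finite ^ 'p"
  assumes c: "0 < c" "\<And>v. c * (norm v)\<^sup>2 \<le> v \<bullet> (C *v v)"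
  shows "continuous_map euclidean loc_unif_topology (\<lambda>u. \<lambda>t\<in>{0..}. limit_minimizer C \<beta> u t)"
proof -
  let ?\<Phi> = "\<lambda>u. \<lambda>t\<in>{0..}. limit_minimizer C \<beta> u t"
  note min = limit_minimizer_is_minimizer[OF c, where \<beta> = \<beta>]
  have mem: "?\<Phi> u \<in> loc_bounded_funs" for u
  proof (rule loc_bounded_funsI)
    show "norm (?\<Phi> u t) \<le> 2 * norm u / c + CARD('p) / c * t" if "0 \<le> t" for t
      using norm_minimizer_le[OF convex_penalty_l1_derivative that c min[OF that], of u] that
      by (simp add: add_divide_distrib mult.commute)
  qed (use c in auto)
  have Lip: "dist (?\<Phi> v t) (?\<Phi> u t) \<le> 2 / c * dist v u" if "0 \<le> t" for u v t
    using minimizer_Lipschitz[OF convex_penalty_l1_derivative that c min[OF that] min[OF that]] that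
    by (simp add: dist_norm)
  have "open {u. ?\<Phi> u \<in> G}" if G: "openin loc_unif_topology G" for G
    unfolding open_dist
  proof (intro ballI)
    fix u assume "u \<in> {u. ?\<Phi> u \<in> G}"
    then obtain K e where K: "K \<subseteq> {0..}" "0 < e"
      "\<And>g. g \<in> loc_bounded_funs \<Longrightarrow> \<forall>t\<in>K. dist (g t) (?\<Phi> u t) < e \<Longrightarrow> g \<in> G"
      using G unfolding openin_loc_unif_topology by blast
    have "?\<Phi> v \<in> G" if v: "dist v u < e * c / 2" for v
    proof (rule K(3)[OF mem], rule ballI)
      fix t assume "t \<in> K"
      then have "dist (?\<Phi> v t) (?\<Phi> u t) \<le> 2 / c * dist v u"
        using K(1) by (intro Lip) auto
      also have "\<dots> < e"
        using v c(1) by (simp add: field_simps)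
      finally show "dist (?\<Phi> v t) (?\<Phi> u t) < e" .
    qed
    then show "\<exists>d>0. \<forall>v. dist v u < d \<longrightarrow> v \<in> {u. ?\<Phi> u \<in> G}"
      using K(2) c(1) by (intro exI[of _ "e * c / 2"]) auto
  qed
  then show ?thesis
    using mem by (simp add: continuous_map_def)
qed

text \<open>The Gram matrix may be singular and the minimizers may be chosen in any way, yet the path is
  even bounded, by the \<open>\<ell>\<^sup>1\<close> norm of the chosen minimizer at \<open>t = 0\<close>.\<close>

lemma lasso_path_loc_bounded:
  fixes x :: "nat \<Rightarrow> real ^ 'p::finite"
  assumes lam: "0 < lam n"
    and min: "\<And>t. 0 \<le> t \<Longrightarrow> is_minimizer (\<lambda>\<phi>. lasso_objective x y lam n \<phi> t) (b t)"
  shows "(\<lambda>t\<in>{0..}. a *\<^sub>R (b t - \<beta>)) \<in> loc_bounded_funs"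
proof (rule loc_bounded_funsI)
  let ?l1 = "\<lambda>\<phi> :: real ^ 'p. \<Sum>i\<in>UNIV. \<bar>\<phi> $ i\<bar>"
  fix t :: real assume t: "0 \<le> t"
  have "?l1 (b t) \<le> ?l1 (b 0)"
  proof (cases "t = 0")
    case False
    with t lam show ?thesis
      by (intro lasso_path_l1_le[OF _ _ min min]) auto
  qed simp
  then have "norm (b t) \<le> ?l1 (b 0)"
    using norm_le_l1_cart[of "b t"] by linarith
  then have "norm (b t - \<beta>) \<le> ?l1 (b 0) + norm \<beta>"
    using norm_triangle_ineq4[of "b t" \<beta>] by linarith
  then show "norm ((\<lambda>t\<in>{0..}. a *\<^sub>R (b t - \<beta>)) t) \<le> \<bar>a\<bar> * (?l1 (b 0) + norm \<beta>) + 0 * t"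
    using t by (simp add: mult_left_mono)
qed auto

theorem theorem2:
  fixes M :: "'a measure" and N :: "'b measure"
    and x :: "nat \<Rightarrow> real ^ 'p::finite"
    and \<beta> :: "real ^ 'p"
    and \<epsilon> y :: "nat \<Rightarrow> 'a \<Rightarrow> real"
    and \<sigma> :: real
    and lam :: "nat \<Rightarrow> real"
    and C :: "real ^ 'p ^ 'p"
    and U :: "'b \<Rightarrow> real ^ 'p"
    and beta_hat :: "nat \<Rightarrow> 'a \<Rightarrow> real \<Rightarrow> real ^ 'p"
  assumes noise: "strong_white_noise M \<epsilon> (\<sigma>\<^sup>2)"
    and model: "\<And>k \<omega>. k \<ge> 1 \<Longrightarrow> \<omega> \<in> space M \<Longrightarrow> y k \<omega> = x k \<bullet> \<beta> + \<epsilon> k \<omega>"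
    and beta_hat: "\<And>n \<omega> t. n \<ge> 1 \<Longrightarrow> \<omega> \<in> space M \<Longrightarrow> t \<ge> 0 \<Longrightarrow>
          is_minimizer (\<lambda>\<phi>. lasso_objective x (\<lambda>k. y k \<omega>) lam n \<phi> t) (beta_hat n \<omega> t)"
    and gram: "gram_matrix x \<longlonglongrightarrow> C" "pos_def_matrix C"
    and negligible: "(\<lambda>n. Max ((\<lambda>k. (norm (x k))\<^sup>2) ` {1..n})) \<in> o(\<lambda>n. real n)"
    and rate: "\<And>n. n \<ge> 1 \<Longrightarrow> lam n = real n powr (- 1 / 2)"
    and gaussian: "gaussian_vector N 0 (\<sigma>\<^sup>2 *\<^sub>R C) U"
  shows "(\<forall>\<omega>\<in>space N. \<forall>t\<ge>0. \<exists>!\<phi>. is_minimizer (\<lambda>\<phi>. limit_objective C \<beta> (U \<omega>) \<phi> t) \<phi>) \<and>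
         weakly_converges loc_unif_topology
           M (\<lambda>n \<omega>. \<lambda>t\<in>{0..}. sqrt (real n) *\<^sub>R (beta_hat n \<omega> t - \<beta>))
           N (\<lambda>\<omega>. \<lambda>t\<in>{0..}. limit_minimizer C \<beta> (U \<omega>) t)"
proof
  obtain c where c: "0 < c" "\<And>v. c * (norm v)\<^sup>2 \<le> v \<bullet> (C *v v)"
    using pos_def_matrix_coercive[OF gram(2)] by blast
  show "\<forall>\<omega>\<in>space N. \<forall>t\<ge>0. \<exists>!\<phi>. is_minimizer (\<lambda>\<phi>. limit_objective C \<beta> (U \<omega>) \<phi> t) \<phi>"
    unfolding limit_objective_eq using ex1_minimizer[OF convex_penalty_l1_derivative _ c] by auto
  define W where "W n \<omega> = score x (\<lambda>k. \<epsilon> k \<omega>) n" for n \<omega>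
  have char_U: "(\<integral>\<omega>. cis (a \<bullet> U \<omega>) \<partial>N) = exp (- (\<sigma>\<^sup>2 * (a \<bullet> (C *v a)) / 2))" for a
  proof -
    have eq: "a \<bullet> ((\<sigma>\<^sup>2 *\<^sub>R C) *v a) = \<sigma>\<^sup>2 * (a \<bullet> (C *v a))"
      by (simp add: scaleR_matrix_vector_assoc[symmetric])
    have "0 \<le> c * (norm a)\<^sup>2"
      using c(1) by simp
    then have "0 \<le> a \<bullet> ((\<sigma>\<^sup>2 *\<^sub>R C) *v a)"
      unfolding eq using c(2)[of a] by simp
    from gaussian_vector_cis_expectation[OF gaussian this] show ?thesis
      by (simp only: eq)
  qed
  show "weakly_converges loc_unif_topology
           M (\<lambda>n \<omega>. \<lambda>t\<in>{0..}. sqrt (real n) *\<^sub>R (beta_hat n \<omega> t - \<beta>))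
           N (\<lambda>\<omega>. \<lambda>t\<in>{0..}. limit_minimizer C \<beta> (U \<omega>) t)"
  proof (rule weakly_convergesI_continuous_image[where W = W])
    show "prob_space M" "prob_space N" "U \<in> borel_measurable N"
      using noise gaussian by (auto simp: strong_white_noise_def gaussian_vector_def)
    interpret M: prob_space M by fact
    have "\<epsilon> k \<in> borel_measurable M" if "k \<in> {1..}" for k
      using noise that by (auto simp: strong_white_noise_def M.indep_vars_def)
    then show "W n \<in> borel_measurable M" for n
      unfolding W_def[abs_def] score_def by (intro borel_measurable_scaleR borel_measurable_sum) auto
    show "(\<lambda>n. \<integral>\<omega>. cis (a \<bullet> W n \<omega>) \<partial>M) \<longlonglongrightarrow> (\<integral>\<omega>. cis (a \<bullet> U \<omega>) \<partial>N)" for a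
      unfolding W_def char_U by (rule score_cis_expectation_tendsto[OF noise gram(1) negligible])
    show "continuous_map euclidean loc_unif_topology (\<lambda>u. \<lambda>t\<in>{0..}. limit_minimizer C \<beta> u t)"
      by (rule continuous_map_limit_minimizer[OF c])
    show "(\<lambda>t\<in>{0..}. sqrt (real n) *\<^sub>R (beta_hat n \<omega> t - \<beta>)) \<in> loc_bounded_funs" if "\<omega> \<in> space M" for n \<omega>
    proof (cases "n = 0")
      case True
      then show ?thesis
        by (intro loc_bounded_funsI[where a = 0 and b = 0]) auto
    next
      case False
      then show ?thesis
        using that beta_hat rate[of n] by (intro lasso_path_loc_bounded[where x = x and y = "\<lambda>k. y k \<omega>" and lam = lam and n = n]) auto
    qed
    fix R T d :: real assume "0 < d"
    have h: "(\<lambda>n. 1 / sqrt (real n)) \<longlonglongrightarrow> 0" "\<forall>\<^sub>F n in sequentially. 0 < 1 / sqrt (real n)"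
      using eventually_gt_at_top[of 0]
      by (auto intro!: tendsto_divide_0[OF tendsto_const] filterlim_at_top_imp_at_infinity
          filterlim_compose[OF sqrt_at_top filterlim_real_sequentially] elim: eventually_mono)
    show "\<forall>\<^sub>F n in sequentially. \<forall>\<omega>\<in>space M. norm (W n \<omega>) \<le> R \<longrightarrow>
        (\<forall>t\<in>{0..T}. dist ((\<lambda>t\<in>{0..}. sqrt (real n) *\<^sub>R (beta_hat n \<omega> t - \<beta>)) t)
          ((\<lambda>t\<in>{0..}. limit_minimizer C \<beta> (W n \<omega>) t) t) < d)"
      using minimizers_converge_uniformly[OF gram(1) c h \<open>0 < d\<close>, of R T \<beta>] eventually_ge_at_top[of 1]
    proof eventually_elim
      case (elim n)
      show ?case
      proof (intro ballI impI)
        fix \<omega> t assume \<omega>: "\<omega> \<in> space M" and "norm (W n \<omega>) \<le> R" and t: "t \<in> {0..T}"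
        have "is_minimizer (penalized_quadratic (W n \<omega>) (gram_matrix x n)
            (l1_difference_quotient \<beta> (1 / sqrt (real n))) t) (sqrt (real n) *\<^sub>R (beta_hat n \<omega> t - \<beta>))"
          unfolding W_def using elim(2) \<omega> t
          by (intro lasso_minimizer_rescaled[OF _ rate _ beta_hat]) (auto simp: model)
        moreover have "is_minimizer (penalized_quadratic (W n \<omega>) C (l1_derivative \<beta>) t)
            (limit_minimizer C \<beta> (W n \<omega>) t)"
          using t by (intro limit_minimizer_is_minimizer[OF c]) auto
        ultimately show "dist ((\<lambda>t\<in>{0..}. sqrt (real n) *\<^sub>R (beta_hat n \<omega> t - \<beta>)) t)
          ((\<lambda>t\<in>{0..}. limit_minimizer C \<beta> (W n \<omega>) t) t) < d"
          using elim(1) \<open>norm (W n \<omega>) \<le> R\<close> t by (auto simp: dist_norm)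
      qed
    qed
  qed
qed

end
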